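(* Let $A=A(q)$ and $B=B(q)$, and let $\alpha=\frac{1+\sqrt5}2$, $\beta=\frac{1-\sqrt5}2$. Suppose that a relation of the form $\Omega(q,A(q),B(q))=0$ holds (identically in $q$), where $\Omega$ is a function of three variables. Then the pentamidiation formula $\Omega(q^{1/5},\mathcal A,\mathcal B)=0$ and the pentication formula $\Omega(q^5,\mathcal C,\mathcal D)=0$ also hold identically, where $$\mathcal A=\sqrt[5]{A^5-3A^4B+4A^3B^2-2A^2B^3+AB^4},\qquad \mathcal B=\sqrt[5]{B^5+3B^4A+4B^3A^2+2B^2A^3+BA^4},$$ $$\mathcal C=\frac{\sqrt[5]{B^5-\alpha^5A^5}-\sqrt[5]{B^5-\beta^5A^5}}{\beta-\alpha},\qquad \mathcal D=\frac{\beta\sqrt[5]{B^5-\alpha^5A^5}-\alpha\sqrt[5]{B^5-\beta^5A^5}}{\beta-\alpha}.$$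
   Context: $q=e^{2\pi i\tau}$ with $\operatorname{Im}\tau>0$, $q^{r}=e^{2\pi ir\tau}$; "identically in $q$" means for all such $\tau$. $(a;q)_\infty=\prod_{k\ge0}(1-aq^k)$, and fractional powers of $(q;q)_\infty$ are the branches whose power series have constant term $1$. The functions $A$ and $B$ are $$A(q)=q^{1/5}(q;q)_\infty^{-3/5}\sum_{n=-\infty}^{\infty}(-1)^nq^{(5n^2-3n)/2},\qquad B(q)=(q;q)_\infty^{-3/5}\sum_{n=-\infty}^{\infty}(-1)^nq^{(5n^2-n)/2}.$$ Branches of fifth roots: $z^{1/5}$ is the branch tending to $1$ as $z\to1$. That is, each fifth root is the holomorphic branch in $\tau$ with leading coefficient $1$ in its expansion as $q\to0$: the roots defining $\mathcal B,\mathcal C,\mathcal D$ are $1+o(1)$, and $\mathcal A=q^{1/25}(1+o(1))$. *)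

theory Defs
  imports "HOL-Complex_Analysis.Complex_Analysis"
begin

text \<open>
  All functions of $q$ are functions of $\tau$ in the upper half-plane, so that fractional powers
  $q^r = e^{2 \pi i r \tau}$ are unambiguous; \<open>qpow 1 \<tau>\<close> is $q$ itself.
\<close>

definition qpow :: "real \<Rightarrow> complex \<Rightarrow> complex" where
  "qpow r \<tau> = exp (2 * of_real pi * \<i> * of_real r * \<tau>)"

definition qpoch_inf :: "complex \<Rightarrow> complex \<Rightarrow> complex" where
  "qpoch_inf a q = (\<Prod>k. 1 - a * q ^ k)"

text \<open>
  The power $(q;q)_\infty^{-3/5}$ for $|q| < 1$: the value at $q$ of the holomorphic $g$ on the unit
  disc with $g(z)^5 = (z;z)_\infty^{-3}$ whose power series has constant term $1$.
\<close>

definition euler_pow :: "complex \<Rightarrow> complex" where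
  "euler_pow q = (THE w. \<exists>g. g holomorphic_on ball 0 1 \<and> g 0 = 1 \<and>
      (\<forall>z\<in>ball 0 1. g z ^ 5 = qpoch_inf z z powi (-3)) \<and> w = g q)"

definition A_fun :: "complex \<Rightarrow> complex" where
  "A_fun \<tau> = qpow (1/5) \<tau> * euler_pow (qpow 1 \<tau>) *
     (\<Sum>\<^sub>\<infinity>n::int. (-1) powi n * qpow ((5 * of_int n ^ 2 - 3 * of_int n) / 2) \<tau>)"

definition B_fun :: "complex \<Rightarrow> complex" where
  "B_fun \<tau> = euler_pow (qpow 1 \<tau>) *
     (\<Sum>\<^sub>\<infinity>n::int. (-1) powi n * qpow ((5 * of_int n ^ 2 - of_int n) / 2) \<tau>)"

text \<open>
  \<open>fifth_root l f\<close> is the holomorphic branch on the upper half-plane of the fifth root of \<open>f\<close> that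
  equals $l(\tau) (1 + o(1))$ as $q \to 0$, that is, as the imaginary part of $\tau$ tends to
  infinity. It need not be the principal root pointwise.
\<close>

definition fifth_root :: "(complex \<Rightarrow> complex) \<Rightarrow> (complex \<Rightarrow> complex) \<Rightarrow> complex \<Rightarrow> complex" where
  "fifth_root l f \<tau> = (THE w. \<exists>g. g holomorphic_on {z. Im z > 0} \<and>
      (\<forall>z. Im z > 0 \<longrightarrow> g z ^ 5 = f z) \<and>
      ((\<lambda>z. g z / l z) \<longlongrightarrow> 1) (filtercomap Im at_top) \<and> w = g \<tau>)"

definition \<alpha> :: complex where "\<alpha> = of_real ((1 + sqrt 5) / 2)"

definition \<beta> :: complex where "\<beta> = of_real ((1 - sqrt 5) / 2)"

definition \<A> :: "complex \<Rightarrow> complex" where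
  "\<A> = fifth_root (qpow (1/25)) (\<lambda>\<tau>. let A = A_fun \<tau>; B = B_fun \<tau> in
     A^5 - 3 * A^4 * B + 4 * A^3 * B^2 - 2 * A^2 * B^3 + A * B^4)"

definition \<B> :: "complex \<Rightarrow> complex" where
  "\<B> = fifth_root (\<lambda>_. 1) (\<lambda>\<tau>. let A = A_fun \<tau>; B = B_fun \<tau> in
     B^5 + 3 * B^4 * A + 4 * B^3 * A^2 + 2 * B^2 * A^3 + B * A^4)"

definition root_alpha :: "complex \<Rightarrow> complex" where
  "root_alpha = fifth_root (\<lambda>_. 1) (\<lambda>\<tau>. B_fun \<tau> ^ 5 - \<alpha> ^ 5 * A_fun \<tau> ^ 5)"

definition root_beta :: "complex \<Rightarrow> complex" where
  "root_beta = fifth_root (\<lambda>_. 1) (\<lambda>\<tau>. B_fun \<tau> ^ 5 - \<beta> ^ 5 * A_fun \<tau> ^ 5)"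

definition \<C> :: "complex \<Rightarrow> complex" where
  "\<C> \<tau> = (root_alpha \<tau> - root_beta \<tau>) / (\<beta> - \<alpha>)"

definition \<D> :: "complex \<Rightarrow> complex" where
  "\<D> \<tau> = (\<beta> * root_alpha \<tau> - \<alpha> * root_beta \<tau>) / (\<beta> - \<alpha>)"

end

theory Submission
  imports Defs
begin

text \<open>
  Write $\theta_\zeta(q) = \sum_n (-1)^n \zeta^n q^{n(n-1)/2}$ for a primitive fifth root of unity $\zeta$.
  Splitting the sum modulo 5 gives
  $(1 - \zeta)(b(q^5) + (\zeta^2 + \zeta^3)\, q\, a(q^5))$, where $a$ and $b$ are the two theta sums in
  $A$ and $B$, while the Jacobi triple product turns $\theta_\zeta$ into an infinite product. Multiplying
  the versions for $\zeta$ and $\zeta^2$ shows that $b^2 - x b - x^2$ (at $q^5$, with $x = q\, a(q^5)$) is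
  $(q;q)_\infty (q^5;q^5)_\infty$, and multiplying over $q \to \zeta^k q$ gives
  $b^{10} - 11 q a^5 b^5 - q^2 a^{10} = (q;q)_\infty^{11} / (q^5;q^5)_\infty$. Together with
  $a b = (q;q)_\infty (q^5;q^5)_\infty$ these determine both $A^5 B^5$ and $B^{10} - A^{10}$ in terms of
  $A(q^5)$ and $B(q^5)$, hence $A^5$ and $B^5$ themselves: they are the quintic forms under the
  roots defining $\mathcal A$ and $\mathcal B$. The combination of the two forms with
  coefficients $1$ and $-\alpha^5$ is the fifth power of $B - \alpha A$ (same for $\beta$), which is
  pentication. Finally, a holomorphic fifth root is determined by its asymptotics at $q \to 0$.
\<close>

subsection \<open>The Jacobi triple product\<close>

definition qpoch :: "nat \<Rightarrow> complex \<Rightarrow> complex \<Rightarrow> complex" where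
  "qpoch n a q = (\<Prod>k<n. 1 - a * q ^ k)"

lemma qpoch_0 [simp]: "qpoch 0 a q = 1"
  by (simp add: qpoch_def)

lemma qpoch_Suc: "qpoch (Suc n) a q = qpoch n a q * (1 - a * q ^ n)"
  by (simp add: qpoch_def)

lemma convergent_prod_qpoch:
  assumes "norm q < 1"
  shows "convergent_prod (\<lambda>k. 1 - a * q ^ k :: complex)"
proof (rule abs_convergent_prod_imp_convergent_prod, rule summable_imp_abs_convergent_prod)
  have "summable (\<lambda>k. norm a * norm q ^ k)"
    using assms by (intro summable_mult summable_geometric) auto
  then show "summable (\<lambda>k. norm (1 - a * q ^ k - 1))"
    by (simp add: norm_mult norm_power)
qed

lemma qpoch_LIMSEQ:
  assumes "norm q < 1"
  shows "(\<lambda>n. qpoch n a q) \<longlonglongrightarrow> qpoch_inf a q"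
proof -
  have "(\<lambda>n. \<Prod>k\<le>n. 1 - a * q ^ k) \<longlonglongrightarrow> qpoch_inf a q"
    unfolding qpoch_inf_def by (rule convergent_prod_LIMSEQ[OF convergent_prod_qpoch[OF assms]])
  then have "(\<lambda>n. qpoch (Suc n) a q) \<longlonglongrightarrow> qpoch_inf a q"
    by (simp add: qpoch_def lessThan_Suc_atMost)
  then show ?thesis
    by (subst (asm) filterlim_sequentially_Suc)
qed

lemma qpoch_inf_nonzero:
  assumes "norm q < 1" "\<And>k. a * q ^ k \<noteq> 1"
  shows "qpoch_inf a q \<noteq> 0"
  unfolding qpoch_inf_def
  by (rule prodinf_nonzero[OF convergent_prod_qpoch[OF assms(1)]]) (use assms(2) in auto)

lemma mult_power_neq_1:
  fixes q a :: complex
  assumes "norm a < 1" "norm q < 1"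
  shows "a * q ^ k \<noteq> 1"
proof
  assume "a * q ^ k = 1"
  then have "norm a * norm q ^ k = 1"
    by (metis norm_mult norm_one norm_power)
  moreover have "norm a * norm q ^ k \<le> norm a * 1"
    using assms by (intro mult_left_mono power_le_one) auto
  ultimately show False
    using assms by simp
qed

lemma qpoch_nonzero:
  assumes "norm a < 1" "norm q < 1"
  shows "qpoch n a q \<noteq> 0"
  using mult_power_neq_1[OF assms] by (auto simp: qpoch_def)

section \<open>Gaussian binomial coefficients and the finite q-binomial theorem\<close>

fun qbin :: "complex \<Rightarrow> nat \<Rightarrow> nat \<Rightarrow> complex" where
  "qbin q n 0 = 1"
| "qbin q 0 (Suc k) = 0"
| "qbin q (Suc n) (Suc k) = qbin q n (Suc k) + q ^ (n - k) * qbin q n k"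

lemma qbin_eq_0: "n < k \<Longrightarrow> qbin q n k = 0"
  by (induction q n k rule: qbin.induct) auto

text \<open>The recursion defining \<open>qbin\<close> is the q-Pascal rule, which needs no
  division. The usual quotient formula follows in cleared form from
  \<open>(1 - q^m) + q^m * (1 - q^(k+1)) = 1 - q^(n+1)\<close> with
  \<open>n = k + m\<close>.\<close>

lemma qbin_qpoch:
  "k \<le> n \<Longrightarrow> qbin q n k * (qpoch k q q * qpoch (n - k) q q) = qpoch n q q"
proof (induction q n k rule: qbin.induct)
  case (3 q n k)
  define m where "m = n - k"
  have n: "n = k + m" using 3 by (simp add: m_def)
  have k: "qbin q n k * (qpoch k q q * qpoch m q q) = qpoch n q q"
    using 3 by (simp add: m_def)
  have pw: "q ^ n = q ^ k * q ^ m" by (simp add: n power_add)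
  show ?case
  proof (cases m)
    case 0
    then show ?thesis
      using k by (auto simp: n qbin_eq_0 qpoch_Suc)
  next
    case (Suc l)
    have k1: "qbin q n (Suc k) * (qpoch (Suc k) q q * qpoch l q q) = qpoch n q q"
      using 3 Suc by (simp add: n)
    have "qbin q (Suc n) (Suc k) * (qpoch (Suc k) q q * qpoch m q q) =
        qbin q n (Suc k) * (qpoch (Suc k) q q * qpoch l q q) * (1 - q * q ^ l) +
        q ^ m * (qbin q n k * (qpoch k q q * qpoch m q q)) * (1 - q * q ^ k)"
      by (simp add: n Suc qpoch_Suc algebra_simps)
    also have "\<dots> = qpoch (Suc n) q q"
      unfolding k k1 by (simp add: qpoch_Suc pw Suc algebra_simps)
    finally show ?thesis by (simp add: n)
  qed
qed auto

text \<open>The new factor \<open>1 + x * q ^ n\<close> reproduces the q-Pascal rule on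
  coefficients, because \<open>q ^ n = q ^ (n - k) * q ^ k\<close> and passing from
  \<open>k choose 2\<close> to \<open>Suc k choose 2\<close> adds \<open>k\<close>.\<close>

lemma qbinomial_theorem:
  "(\<Prod>k<n. 1 + x * q ^ k) = (\<Sum>k\<le>n. qbin q n k * q ^ (k choose 2) * x ^ k)"
proof (induction n)
  case (Suc n)
  let ?t = "\<lambda>k. qbin q n k * q ^ (k choose 2) * x ^ k"
  have step: "qbin q (Suc n) (Suc k) * q ^ (Suc k choose 2) * x ^ Suc k =
      ?t (Suc k) + x * q ^ n * ?t k" if "k \<le> n" for k
  proof -
    have "Suc k choose 2 = k + (k choose 2)" by (simp add: numeral_2_eq_2)
    moreover have "q ^ n = q ^ (n - k) * q ^ k"
      using that by (simp flip: power_add)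
    ultimately show ?thesis
      by (simp add: power_add algebra_simps)
  qed
  have "(\<Sum>k\<le>Suc n. qbin q (Suc n) k * q ^ (k choose 2) * x ^ k) =
      1 + (\<Sum>k\<le>n. qbin q (Suc n) (Suc k) * q ^ (Suc k choose 2) * x ^ Suc k)"
    by (subst sum.atMost_Suc_shift) (simp add: binomial_eq_0)
  also have "\<dots> = 1 + (\<Sum>k\<le>n. ?t (Suc k)) + x * q ^ n * (\<Sum>k\<le>n. ?t k)"
    using step by (simp add: sum.distrib sum_distrib_left)
  also have "1 + (\<Sum>k\<le>n. ?t (Suc k)) = (\<Sum>k\<le>Suc n. ?t k)"
    by (subst sum.atMost_Suc_shift) (simp add: binomial_eq_0)
  also have "\<dots> = (\<Sum>k\<le>n. ?t k)"
    by (simp add: qbin_eq_0)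
  finally show ?case
    by (simp add: Suc algebra_simps)
qed (auto simp: binomial_eq_0)

section \<open>The bilateral theta series; the halved exponent is exact because
  \<open>n * (n - 1)\<close> is even\<close>

definition theta_term :: "complex \<Rightarrow> complex \<Rightarrow> int \<Rightarrow> complex" where
  "theta_term q z n = (-1) powi n * q powi (n * (n - 1) div 2) * z powi n"

lemma even_mult_pred: "\<exists>c. n * (n - 1) = 2 * c" for n :: int
  by (metis dvdE even_diff even_mult_iff even_plus_one_iff)

lemma theta_term_nat: "theta_term q z (int n) = q ^ (n choose 2) * (- z) ^ n"
proof -
  have "int n * (int n - 1) div 2 = int (n choose 2)"
    by (cases n) (auto simp: choose_two zdiv_int algebra_simps)
  then have "q powi (int n * (int n - 1) div 2) = q ^ (n choose 2)"
    by simp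
  then show ?thesis
    by (simp add: theta_term_def power_minus[of z] mult_ac)
qed

text \<open>Reflecting the index raises the exponent of \<open>q\<close> by \<open>n\<close>, which
  turns \<open>z\<close> into \<open>q / z\<close>. The negative half of a theta series is thus a
  one-sided series of the same kind.\<close>

lemma theta_term_neg:
  assumes "q \<noteq> 0" "z \<noteq> 0"
  shows "theta_term q z (- n) = theta_term q (q / z) n"
proof -
  obtain c where c: "n * (n - 1) = 2 * c"
    using even_mult_pred by blast
  have "- n * (- n - 1) = 2 * (c + n)"
    using c by (simp add: algebra_simps)
  with c have "- n * (- n - 1) div 2 = n * (n - 1) div 2 + n"
    by simp
  then show ?thesis
    using assms by (simp add: theta_term_def power_int_add power_int_divide_distrib power_int_minus divide_simps
        flip: power_int_mult_distrib)
qed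

text \<open>Consecutive terms have ratio \<open>q ^ n * w\<close>, which tends to 0, so the ratio
  test applies for every \<open>w\<close>.\<close>

lemma summable_theta_nat:
  fixes q w :: complex
  assumes "norm q < 1"
  shows "summable (\<lambda>n. norm (q ^ (n choose 2) * w ^ n))"
proof -
  have "(\<lambda>n. norm (q ^ n * w)) \<longlonglongrightarrow> 0"
    using assms by (intro tendsto_norm_zero tendsto_mult_left_zero LIMSEQ_power_zero)
  then have "eventually (\<lambda>n. norm (q ^ n * w) < 1/2) sequentially"
    by (rule order_tendstoD) simp
  then obtain N where N: "\<And>n. n \<ge> N \<Longrightarrow> norm (q ^ n * w) < 1/2"
    by (auto simp: eventually_at_top_linorder)
  show ?thesis
  proof (rule summable_ratio_test[where c = "1/2" and N = N])
    fix n assume "n \<ge> N"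
    have "Suc n choose 2 = n + (n choose 2)" by (simp add: numeral_2_eq_2)
    then have "q ^ (Suc n choose 2) * w ^ Suc n = (q ^ n * w) * (q ^ (n choose 2) * w ^ n)"
      by (simp add: power_add mult_ac)
    then have "norm (q ^ (Suc n choose 2) * w ^ Suc n) = norm (q ^ n * w) * norm (q ^ (n choose 2) * w ^ n)"
      by (metis norm_mult)
    also have "\<dots> \<le> 1/2 * norm (q ^ (n choose 2) * w ^ n)"
      using N[OF \<open>n \<ge> N\<close>] by (intro mult_right_mono) auto
    finally show "norm (norm (q ^ (Suc n choose 2) * w ^ Suc n)) \<le> 1/2 * norm (norm (q ^ (n choose 2) * w ^ n))"
      by simp
  qed auto
qed

lemma theta_term_summable_on:
  assumes "norm q < 1" "q \<noteq> 0" "z \<noteq> 0"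
  shows "(\<lambda>n. norm (theta_term q z n)) summable_on UNIV"
proof -
  have nat: "(\<lambda>n. norm (theta_term q w (int n))) summable_on UNIV" for w
    using summable_theta_nat[OF assms(1), of "- w"]
    by (intro norm_summable_imp_summable_on) (simp add: theta_term_nat)
  have "(\<lambda>n. norm (theta_term q z n)) summable_on range int"
    using nat[of z] by (subst summable_on_reindex) (auto simp: o_def)
  moreover have "(\<lambda>n. norm (theta_term q z n)) summable_on range (\<lambda>n. - int n)"
    using nat[of "q / z"] assms by (subst summable_on_reindex) (auto simp: o_def theta_term_neg inj_def)
  moreover have "range int \<union> range (\<lambda>n. - int n) = UNIV"
  proof -
    have "x \<in> range int \<union> range (\<lambda>n. - int n)" for x by (cases x rule: int_cases2) auto
    then show ?thesis by blast
  qed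
  ultimately show ?thesis
    using summable_on_union by metis
qed

text \<open>A truncated triple product: the q-binomial theorem with \<open>2 * n\<close> factors,
  shifted so that half of the factors form \<open>qpoch n z q\<close> and the other half, read
  backwards, form \<open>qpoch n (q / z) q\<close> up to a monomial. Recentring the index at
  \<open>n\<close> makes the sum symmetric.\<close>

lemma theta_finite:
  assumes q: "q \<noteq> 0" and z: "z \<noteq> 0"
  shows "qpoch n z q * qpoch n (q / z) q =
    (\<Sum>i\<in>{-int n..int n}. theta_term q z i * qbin q (2 * n) (nat (int n + i)))"
proof -
  define x where "x = - z / q ^ n"
  \<comment> \<open>The monomial pulled out of the lower \<open>n\<close> factors, namely the
    product of \<open>- z / q ^ Suc k\<close> over \<open>k < n\<close>.\<close>
  define c where "c = (- z) ^ n / q ^ (Suc n choose 2)"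
  have [simp]: "c \<noteq> 0" using q z by (simp add: c_def)
  have ch: "Suc k choose 2 = k + (k choose 2)" for k by (simp add: numeral_2_eq_2)
  have lower: "(\<Prod>k<n. 1 + x * q ^ k) = c * qpoch n (q / z) q"
  proof -
    have "(\<Prod>k<n. 1 + x * q ^ k) = (\<Prod>k<n. 1 + x * q ^ (n - Suc k))"
      by (rule prod.nat_diff_reindex[symmetric])
    also have "\<dots> = (\<Prod>k<n. - z / q ^ Suc k * (1 - q / z * q ^ k))"
    proof (rule prod.cong)
      fix k assume "k \<in> {..<n}"
      then have "q ^ n = q ^ (n - Suc k) * q ^ Suc k"
        by (subst power_add[symmetric]) simp
      then show "1 + x * q ^ (n - Suc k) = - z / q ^ Suc k * (1 - q / z * q ^ k)"
        using q z by (simp add: x_def field_simps)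
    qed auto
    also have "\<dots> = (\<Prod>k<n. - z / q ^ Suc k) * qpoch n (q / z) q"
      unfolding qpoch_def by (rule prod.distrib)
    also have "(\<Prod>k<n. - z / q ^ Suc k) = c"
      unfolding c_def
      by (induction n) (simp_all add: ch[of "Suc _"] power_add field_simps q, simp add: binomial_eq_0)
    finally show ?thesis .
  qed
  have "(\<Prod>k<2*n. 1 + x * q ^ k) = (\<Prod>k<n. 1 + x * q ^ k) * (\<Prod>k<n. 1 + x * q ^ (k + n))"
    using prod.atLeastLessThan_concat[of 0 n "2*n" "\<lambda>k. 1 + x * q ^ k"]
      prod.shift_bounds_nat_ivl[of "\<lambda>k. 1 + x * q ^ k" 0 n n]
    by (simp add: atLeast0LessThan mult_2)
  also have "(\<Prod>k<n. 1 + x * q ^ (k + n)) = qpoch n z q"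
    using q by (simp add: qpoch_def x_def power_add)
  finally have "c * (qpoch n z q * qpoch n (q / z) q) = (\<Prod>k<2*n. 1 + x * q ^ k)"
    by (simp add: lower)
  also have "\<dots> = (\<Sum>k\<le>2*n. qbin q (2*n) k * q ^ (k choose 2) * x ^ k)"
    by (rule qbinomial_theorem)
  also have "\<dots> = (\<Sum>i\<in>{-int n..int n}. c * (theta_term q z i * qbin q (2 * n) (nat (int n + i))))"
  proof (rule sum.reindex_bij_witness[of _ "\<lambda>i. nat (int n + i)" "\<lambda>k. int k - int n"])
    fix k assume "k \<in> {..2*n}"
    define i where "i = int k - int n"
    have choose: "int (m choose 2) = int m * (int m - 1) div 2" for m
      by (cases m) (auto simp: choose_two zdiv_int algebra_simps)
    obtain c1 where c1: "int k * (int k - 1) = 2 * c1" using even_mult_pred by blast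
    obtain c2 where c2: "int (Suc n) * (int (Suc n) - 1) = 2 * c2" using even_mult_pred by blast
    obtain c3 where c3: "i * (i - 1) = 2 * c3" using even_mult_pred by blast
    \<comment> \<open>The exponents of \<open>q\<close> agree by a quadratic identity in
      \<open>n\<close> and \<open>k\<close>. The witnesses \<open>c1\<close>, \<open>c2\<close>,
      \<open>c3\<close> are exact halves, so the identity is checked after doubling, without
      \<open>div\<close>.\<close>
    have "2 * (int n * int k + c3) = 2 * (c1 + c2)"
      unfolding distrib_left c1[symmetric] c2[symmetric] c3[symmetric] i_def by (simp add: algebra_simps)
    then have expo: "int (n * k) + i * (i - 1) div 2 = int (k choose 2) + int (Suc n choose 2)"
      unfolding choose c1 c2 c3 by simp
    have "q ^ (n * k) * q powi (i * (i - 1) div 2) = q powi (int (n * k) + i * (i - 1) div 2)"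
      using q by (subst power_int_add) (simp, simp only: power_int_of_nat)
    also have "\<dots> = q ^ (k choose 2) * q ^ (Suc n choose 2)"
      unfolding expo using q by (subst power_int_add) auto
    finally have qq: "q ^ (n * k) * q powi (i * (i - 1) div 2) = q ^ (k choose 2) * q ^ (Suc n choose 2)" .
    have "int k = i + int n" by (simp add: i_def)
    then have "(- z) ^ k = (- z) powi i * (- z) ^ n"
      by (metis power_int_add power_int_of_nat neg_equal_0_iff_equal z)
    also have "(- z) powi i = (-1) powi i * z powi i"
      by (metis mult_minus1 power_int_mult_distrib)
    finally have zz: "(- z) ^ k = (-1) powi i * z powi i * (- z) ^ n" .
    have xk: "x ^ k = (- z) ^ k / q ^ (n * k)"
      unfolding x_def by (simp only: power_divide power_mult)
    have "c * theta_term q z i * (q ^ (Suc n choose 2) * q ^ (n * k)) =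
        (- z) ^ k * (q ^ (n * k) * q powi (i * (i - 1) div 2))"
      using q by (simp add: c_def theta_term_def zz)
    also have "\<dots> = q ^ (k choose 2) * x ^ k * (q ^ (Suc n choose 2) * q ^ (n * k))"
      unfolding qq xk using q by simp
    finally have "c * theta_term q z i = q ^ (k choose 2) * x ^ k"
      using q by simp
    then show "c * (theta_term q z (int k - int n) * qbin q (2 * n) (nat (int n + (int k - int n))))
        = qbin q (2 * n) k * q ^ (k choose 2) * x ^ k"
      by (simp add: i_def mult_ac)
  qed auto
  finally show ?thesis
    by (simp flip: sum_distrib_left)
qed

text \<open>Let \<open>n\<close> tend to infinity in \<open>theta_finite\<close>. Each coefficient
  \<open>qbin q (2 * n) (n + i)\<close> tends to the inverse of \<open>qpoch_inf q q\<close>, and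
  all of them are bounded uniformly in \<open>n\<close> and \<open>i\<close>, so dominated
  convergence exchanges limit and sum.\<close>

lemma jacobi_triple_product:
  assumes q1: "norm q < 1" and q: "q \<noteq> 0" and z: "z \<noteq> 0"
  shows "(theta_term q z has_sum qpoch_inf z q * qpoch_inf (q / z) q * qpoch_inf q q) UNIV"
proof -
  define E where "E = qpoch_inf q q"
  have E: "E \<noteq> 0"
    unfolding E_def by (rule qpoch_inf_nonzero[OF q1 mult_power_neq_1[OF q1 q1]])
  have Elim: "(\<lambda>n. qpoch n q q) \<longlonglongrightarrow> E"
    unfolding E_def by (rule qpoch_LIMSEQ[OF q1])
  have nz: "qpoch n q q \<noteq> 0" for n by (rule qpoch_nonzero[OF q1 q1])
  obtain K where K: "K > 0" "\<And>n. norm (qpoch n q q) \<le> K"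
    using convergent_imp_Bseq[OF convergentI[OF Elim]] by (auto simp: Bseq_def)
  obtain L where L: "L > 0" "\<And>n. norm (inverse (qpoch n q q)) \<le> L"
    using convergent_imp_Bseq[OF convergentI[OF tendsto_inverse[OF Elim E]]] by (auto simp: Bseq_def)
  \<comment> \<open>Extending the coefficients by zero makes every truncated sum range over all
    integers, so that only the coefficients depend on \<open>n\<close>.\<close>
  define b where "b n i = (if i \<in> {-int n..int n} then qbin q (2 * n) (nat (int n + i)) else 0)" for n i
  have b_eq: "b n i = qpoch (2 * n) q q * inverse (qpoch (nat (int n + i)) q q) * inverse (qpoch (nat (int n - i)) q q)"
    if "i \<in> {-int n..int n}" for n i
  proof -
    have "2 * n - nat (int n + i) = nat (int n - i)" "nat (int n + i) \<le> 2 * n" using that by auto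
    then show ?thesis
      using qbin_qpoch[of "nat (int n + i)" "2 * n" q] that nz by (simp add: b_def field_simps)
  qed
  have b_bound: "norm (b n i) \<le> K * L * L" for n i
  proof (cases "i \<in> {-int n..int n}")
    case True
    show ?thesis
      unfolding b_eq[OF True] norm_mult using K L by (intro mult_mono) auto
  qed (use K L in \<open>auto simp: b_def\<close>)
  have b_lim: "(\<lambda>n. b n i) \<longlonglongrightarrow> inverse E" for i
  proof -
    have lim: "filterlim (\<lambda>n. nat (int n + j)) sequentially sequentially" for j
    proof (rule filterlim_at_top_mono)
      show "filterlim (\<lambda>n. n - nat \<bar>j\<bar>) sequentially sequentially"
        by (rule filterlim_minus_const_nat_at_top)
    qed (auto intro!: always_eventually)
    have "(\<lambda>n. qpoch (2 * n) q q * inverse (qpoch (nat (int n + i)) q q) * inverse (qpoch (nat (int n - i)) q q))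
        \<longlonglongrightarrow> E * inverse E * inverse E"
      using lim[of "- i"]
      by (intro tendsto_mult tendsto_inverse E filterlim_compose[OF Elim] lim)
         (auto intro: mult_nat_left_at_top)
    moreover have "eventually (\<lambda>n. qpoch (2 * n) q q * inverse (qpoch (nat (int n + i)) q q) *
        inverse (qpoch (nat (int n - i)) q q) = b n i) sequentially"
      by (rule eventually_sequentiallyI[of "nat \<bar>i\<bar>"], subst b_eq) auto
    ultimately show ?thesis
      using E by (simp add: tendsto_cong)
  qed
  \<comment> \<open>The integers are enumerated by \<open>int_decode\<close>, since Tannery's
    theorem is applied to a series over the naturals; absolute summability makes the order
    irrelevant.\<close>
  let ?t = "\<lambda>k. theta_term q z (int_decode k)"
  have t_summable: "summable (\<lambda>k. norm (?t k))"
    using theta_term_summable_on[OF q1 q z]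
    by (intro summable_on_imp_summable) (subst summable_on_reindex_bij_betw[OF bij_int_decode])
  have sum_eq: "(\<Sum>k. ?t k * b n (int_decode k)) = qpoch n z q * qpoch n (q / z) q" for n
  proof -
    have "(\<lambda>k. ?t k * b n (int_decode k)) sums (\<Sum>k\<in>int_encode ` {-int n..int n}. ?t k * b n (int_decode k))"
    proof (rule sums_finite)
      fix k assume k: "k \<notin> int_encode ` {-int n..int n}"
      have "int_decode k \<notin> {-int n..int n}"
        using k by (metis image_eqI int_decode_inverse)
      then show "?t k * b n (int_decode k) = 0" unfolding b_def by (simp only: if_not_P mult_zero_right if_False)
    qed auto
    also have "(\<Sum>k\<in>int_encode ` {-int n..int n}. ?t k * b n (int_decode k)) =
        (\<Sum>i\<in>{-int n..int n}. theta_term q z i * b n i)"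
      by (subst sum.reindex) (auto intro: inj_on_subset[OF inj_int_encode])
    also have "\<dots> = qpoch n z q * qpoch n (q / z) q"
      unfolding theta_finite[OF q z] by (intro sum.cong) (auto simp: b_def)
    finally show ?thesis by (rule sums_unique[symmetric])
  qed
  have tan: "(\<lambda>n. \<Sum>k. ?t k * b n (int_decode k)) \<longlonglongrightarrow> (\<Sum>k. ?t k * inverse E)"
    and sm: "summable (\<lambda>k. norm (?t k * inverse E))"
  proof -
    have "eventually (\<lambda>(k, n). norm (?t k * b n (int_decode k)) \<le> norm (?t k) * (K * L * L)) (at_top \<times>\<^sub>F sequentially)"
      by (intro always_eventually) (auto simp: norm_mult intro!: mult_left_mono b_bound)
    from tannerys_theorem[OF tendsto_mult[OF tendsto_const b_lim] this summable_mult2[OF t_summable]]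
    show "(\<lambda>n. \<Sum>k. ?t k * b n (int_decode k)) \<longlonglongrightarrow> (\<Sum>k. ?t k * inverse E)"
      "summable (\<lambda>k. norm (?t k * inverse E))" by simp_all
  qed
  have "(\<lambda>n. qpoch n z q * qpoch n (q / z) q) \<longlonglongrightarrow> qpoch_inf z q * qpoch_inf (q / z) q"
    by (intro tendsto_mult qpoch_LIMSEQ q1)
  with tan have "(\<Sum>k. ?t k * inverse E) = qpoch_inf z q * qpoch_inf (q / z) q"
    unfolding sum_eq using LIMSEQ_unique by blast
  with sm have "(\<lambda>k. ?t k * inverse E) sums (qpoch_inf z q * qpoch_inf (q / z) q)"
    by (metis summable_norm_cancel summable_sums)
  with sm have "((\<lambda>k. ?t k * inverse E) has_sum (qpoch_inf z q * qpoch_inf (q / z) q)) UNIV"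
    by (rule norm_summable_imp_has_sum)
  then have "((\<lambda>k. ?t k * inverse E * E) has_sum (qpoch_inf z q * qpoch_inf (q / z) q * E)) UNIV"
    by (rule has_sum_cmult_left)
  then have "(?t has_sum (qpoch_inf z q * qpoch_inf (q / z) q * E)) UNIV"
    using E by (simp add: mult.assoc)
  then show ?thesis
    unfolding E_def using has_sum_reindex_bij_betw[OF bij_int_decode] by blast
qed

subsection \<open>Products over fifth roots of unity\<close>

definition euler :: "complex \<Rightarrow> complex" where
  "euler q = qpoch_inf q q"

text \<open>Product sides of the theta sums in \<open>A_fun\<close> and \<open>B_fun\<close>,
  without the fractional power of \<open>q\<close> and the normalizing factor; they are
  Rogers-Ramanujan type products.\<close>

definition rr_a :: "complex \<Rightarrow> complex" where
  "rr_a q = qpoch_inf q (q ^ 5) * qpoch_inf (q ^ 4) (q ^ 5) * qpoch_inf (q ^ 5) (q ^ 5)"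

definition rr_b :: "complex \<Rightarrow> complex" where
  "rr_b q = qpoch_inf (q ^ 2) (q ^ 5) * qpoch_inf (q ^ 3) (q ^ 5) * qpoch_inf (q ^ 5) (q ^ 5)"

lemma euler_0 [simp]: "euler 0 = 1" and rr_a_0 [simp]: "rr_a 0 = 1" and rr_b_0 [simp]: "rr_b 0 = 1"
  by (simp_all add: euler_def rr_a_def rr_b_def qpoch_inf_def)

lemma norm_power_less_1: "norm (q :: complex) < 1 \<Longrightarrow> n > 0 \<Longrightarrow> norm (q ^ n) < 1"
  by (simp add: norm_power power_less_one_iff)

lemma euler_nonzero: "norm q < 1 \<Longrightarrow> euler q \<noteq> 0"
  unfolding euler_def by (intro qpoch_inf_nonzero mult_power_neq_1)

lemma qpoch_inf_eqI:
  assumes "f \<longlonglongrightarrow> L" "norm q < 1" "\<And>n. f n = qpoch n a q"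
  shows "L = qpoch_inf a q"
proof -
  have "f = (\<lambda>n. qpoch n a q)" using assms(3) by auto
  with assms(1) show ?thesis
    using LIMSEQ_unique qpoch_LIMSEQ[OF assms(2), of a] by blast
qed

lemma qpoch_inf_Suc:
  assumes "norm q < 1"
  shows "qpoch_inf a q = (1 - a) * qpoch_inf (a * q) q"
proof (rule LIMSEQ_unique)
  show "(\<lambda>n. qpoch (Suc n) a q) \<longlonglongrightarrow> qpoch_inf a q"
    by (subst filterlim_sequentially_Suc) (rule qpoch_LIMSEQ[OF assms])
  have "qpoch (Suc n) a q = (1 - a) * qpoch n (a * q) q" for n
    unfolding qpoch_def by (subst prod.lessThan_Suc_shift) (simp add: mult_ac)
  then show "(\<lambda>n. qpoch (Suc n) a q) \<longlonglongrightarrow> (1 - a) * qpoch_inf (a * q) q"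
    by (simp add: tendsto_mult_left qpoch_LIMSEQ[OF assms])
qed

text \<open>The factors \<open>1 - q ^ m\<close> are sorted by \<open>m\<close> modulo 5, taking the
  partial products in blocks of five.\<close>

lemma euler_quintisection:
  assumes "norm q < 1"
  shows "euler q = qpoch_inf q (q ^ 5) * qpoch_inf (q ^ 2) (q ^ 5) * qpoch_inf (q ^ 3) (q ^ 5) *
    qpoch_inf (q ^ 4) (q ^ 5) * qpoch_inf (q ^ 5) (q ^ 5)"
proof (rule LIMSEQ_unique)
  have q5: "norm (q ^ 5) < 1" using assms by (intro norm_power_less_1) auto
  show "(\<lambda>n. qpoch (5 * n) q q) \<longlonglongrightarrow> euler q"
    unfolding euler_def
    by (rule filterlim_compose[OF qpoch_LIMSEQ[OF assms]]) (rule mult_nat_left_at_top, simp)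
  have "qpoch (5 * n) q q = qpoch n q (q ^ 5) * qpoch n (q ^ 2) (q ^ 5) * qpoch n (q ^ 3) (q ^ 5) *
    qpoch n (q ^ 4) (q ^ 5) * qpoch n (q ^ 5) (q ^ 5)" for n
  proof (induction n)
    case (Suc n)
    have f: "q * q ^ (5 * n + j) = q ^ Suc j * (q ^ 5) ^ n" for j
      by (simp add: power_add mult_ac flip: power_mult)
    have "qpoch (5 * Suc n) q q = qpoch (5 * n + 5) q q" by (simp add: add.commute)
    also have "\<dots> = qpoch (5 * n) q q * (1 - q * q ^ (5 * n + 0)) * (1 - q * q ^ (5 * n + 1)) *
        (1 - q * q ^ (5 * n + 2)) * (1 - q * q ^ (5 * n + 3)) * (1 - q * q ^ (5 * n + 4))"
      by (simp add: qpoch_Suc numeral_eq_Suc)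
    finally show ?case
      unfolding f Suc.IH qpoch_Suc by (simp add: mult_ac power2_eq_square)
  qed auto
  then show "(\<lambda>n. qpoch (5 * n) q q) \<longlonglongrightarrow> qpoch_inf q (q ^ 5) * qpoch_inf (q ^ 2) (q ^ 5) *
      qpoch_inf (q ^ 3) (q ^ 5) * qpoch_inf (q ^ 4) (q ^ 5) * qpoch_inf (q ^ 5) (q ^ 5)"
    by (simp add: tendsto_mult qpoch_LIMSEQ[OF q5])
qed

lemma rr_a_mult_rr_b:
  assumes "norm q < 1"
  shows "rr_a q * rr_b q = euler q * euler (q ^ 5)"
  unfolding euler_quintisection[OF assms] rr_a_def rr_b_def by (simp add: euler_def)

text \<open>As 5 is prime, such a \<open>\<zeta>\<close> is primitive. Leaving it arbitrary allows
  the results to be reused with powers of \<open>\<zeta>\<close> in its place.\<close>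

locale fifth_root_unity =
  fixes \<zeta> :: complex
  assumes power_5: "\<zeta> ^ 5 = 1" and neq_1: "\<zeta> \<noteq> 1"
begin

lemma sum_powers: "1 + \<zeta> + \<zeta> ^ 2 + \<zeta> ^ 3 + \<zeta> ^ 4 = 0"
proof -
  have "(\<zeta> - 1) * (1 + \<zeta> + \<zeta> ^ 2 + \<zeta> ^ 3 + \<zeta> ^ 4) = \<zeta> ^ 5 - 1"
    by (simp add: algebra_simps eval_nat_numeral)
  then show ?thesis using power_5 neq_1 by simp
qed

lemma power_6: "\<zeta> ^ 6 = \<zeta>" and power_7: "\<zeta> ^ 7 = \<zeta> ^ 2"
  using power_5 by (simp_all add: eval_nat_numeral mult.assoc)

lemma nonzero: "\<zeta> \<noteq> 0"
  using power_5 by auto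

lemma norm_eq_1: "norm \<zeta> = 1"
  by (rule power_eq_imp_eq_base[of _ 5]) (simp_all add: power_5 flip: norm_power)

lemma power_root: "\<not> 5 dvd r \<Longrightarrow> fifth_root_unity (\<zeta> ^ r)"
proof
  assume r: "\<not> 5 dvd r"
  show "(\<zeta> ^ r) ^ 5 = 1"
    by (metis mult.commute power_5 power_mult power_one)
  show "\<zeta> ^ r \<noteq> 1"
  proof
    assume "\<zeta> ^ r = 1"
    moreover have "coprime r 5"
      using r prime_imp_coprime[of "5::nat" r] by (simp add: coprime_commute)
    then obtain x y where "r * x = 5 * y + 1"
      by (metis bezout_nat coprime_imp_gcd_eq_1 r dvd_0_right)
    ultimately have "1 = \<zeta> ^ (5 * y + 1)"
      by (metis power_mult power_one)
    then show False using power_5 neq_1 by (simp add: power_add power_mult)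
  qed
qed

text \<open>Pairing the inverse roots \<open>\<zeta>\<close>, \<open>\<zeta> ^ 4\<close> and
  \<open>\<zeta> ^ 2\<close>, \<open>\<zeta> ^ 3\<close> gives two quadratics whose middle
  coefficients are the Gaussian periods \<open>s\<close> and \<open>t\<close>, with sum and product
  both -1.\<close>

lemma prod_diff_mult:
  "(b - x) * (b - \<zeta> * x) * (b - \<zeta> ^ 2 * x) * (b - \<zeta> ^ 3 * x) * (b - \<zeta> ^ 4 * x) = b ^ 5 - x ^ 5"
proof -
  define s where "s = \<zeta> + \<zeta> ^ 4"
  define t where "t = \<zeta> ^ 2 + \<zeta> ^ 3"
  have t: "t = - 1 - s"
    using sum_powers by (simp add: s_def t_def algebra_simps add_eq_0_iff)
  have "s * t = \<zeta> ^ 2 * \<zeta> + \<zeta> ^ 3 * \<zeta> + \<zeta> ^ 6 + \<zeta> ^ 7"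
    by (simp add: s_def t_def algebra_simps flip: power_add)
  also have "\<dots> = -1"
    using sum_powers unfolding power_6 power_7
    by (simp add: eval_nat_numeral mult_ac add_ac add_eq_0_iff)
  finally have st: "s * t = -1" .
  have "(b - \<zeta> * x) * (b - \<zeta> ^ 4 * x) = b ^ 2 - s * x * b + \<zeta> ^ 5 * x ^ 2"
    by (simp add: s_def algebra_simps eval_nat_numeral)
  moreover have "(b - \<zeta> ^ 2 * x) * (b - \<zeta> ^ 3 * x) = b ^ 2 - t * x * b + \<zeta> ^ 5 * x ^ 2"
    by (simp add: t_def algebra_simps eval_nat_numeral)
  ultimately have "(b - x) * ((b - \<zeta> * x) * (b - \<zeta> ^ 4 * x)) * ((b - \<zeta> ^ 2 * x) * (b - \<zeta> ^ 3 * x)) =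
      (b - x) * (b ^ 2 - s * x * b + x ^ 2) * (b ^ 2 - t * x * b + x ^ 2)"
    by (simp add: power_5)
  also have "\<dots> = b ^ 5 - x ^ 5"
    using st t by algebra
  finally show ?thesis by (simp add: mult_ac)
qed

lemma prod_qpoch_inf:
  assumes "norm q < 1"
  shows "qpoch_inf x q * qpoch_inf (\<zeta> * x) q * qpoch_inf (\<zeta> ^ 2 * x) q * qpoch_inf (\<zeta> ^ 3 * x) q *
    qpoch_inf (\<zeta> ^ 4 * x) q = qpoch_inf (x ^ 5) (q ^ 5)"
proof (rule qpoch_inf_eqI)
  show "(\<lambda>n. qpoch n x q * qpoch n (\<zeta> * x) q * qpoch n (\<zeta> ^ 2 * x) q * qpoch n (\<zeta> ^ 3 * x) q *
      qpoch n (\<zeta> ^ 4 * x) q) \<longlonglongrightarrow> qpoch_inf x q * qpoch_inf (\<zeta> * x) q * qpoch_inf (\<zeta> ^ 2 * x) q *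
      qpoch_inf (\<zeta> ^ 3 * x) q * qpoch_inf (\<zeta> ^ 4 * x) q"
    by (intro tendsto_mult qpoch_LIMSEQ assms)
  show "norm (q ^ 5) < 1" using assms by (intro norm_power_less_1) auto
  fix n
  show "qpoch n x q * qpoch n (\<zeta> * x) q * qpoch n (\<zeta> ^ 2 * x) q * qpoch n (\<zeta> ^ 3 * x) q *
      qpoch n (\<zeta> ^ 4 * x) q = qpoch n (x ^ 5) (q ^ 5)"
    unfolding qpoch_def prod.distrib[symmetric]
  proof (rule prod.cong)
    fix k
    have "x ^ 5 * (q ^ 5) ^ k = (x * q ^ k) ^ 5"
      by (simp add: power_mult_distrib mult.commute flip: power_mult)
    then show "(1 - x * q ^ k) * (1 - \<zeta> * x * q ^ k) * (1 - \<zeta> ^ 2 * x * q ^ k) * (1 - \<zeta> ^ 3 * x * q ^ k) *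
        (1 - \<zeta> ^ 4 * x * q ^ k) = 1 - x ^ 5 * (q ^ 5) ^ k"
      using prod_diff_mult[of 1 "x * q ^ k"] by (simp only: mult.assoc power_one)
  qed auto
qed

text \<open>Quintisect each factor. Over the five roots, a residue class prime to 5 yields the same
  class with \<open>q ^ 5\<close> for \<open>q\<close>, whereas the class of multiples of 5 yields
  \<open>euler (q ^ 5)\<close> five times. The four new classes and \<open>euler (q ^ 25)\<close>
  reassemble into one more \<open>euler (q ^ 5)\<close>.\<close>

lemma prod_euler:
  assumes "norm q < 1"
  shows "euler q * euler (\<zeta> * q) * euler (\<zeta> ^ 2 * q) * euler (\<zeta> ^ 3 * q) * euler (\<zeta> ^ 4 * q) * euler (q ^ 25)
    = euler (q ^ 5) ^ 6"
proof -
  have q5: "norm (q ^ 5) < 1" using assms by (intro norm_power_less_1) auto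
  \<comment> \<open>The part of \<open>euler (\<zeta> ^ k * q)\<close> formed by the exponents
    congruent to \<open>r\<close> modulo 5.\<close>
  define h where "h k r = qpoch_inf ((\<zeta> ^ r) ^ k * q ^ r) (q ^ 5)" for k r :: nat
  have z5: "\<zeta> ^ (k * 5) = 1" for k
    by (metis mult.commute power_5 power_mult power_one)
  have e: "euler (\<zeta> ^ k * q) = h k 1 * h k 2 * h k 3 * h k 4 * h k 5" for k
    using assms
    by (subst euler_quintisection)
       (simp_all add: norm_mult norm_power norm_eq_1 h_def power_mult_distrib z5 mult_ac flip: power_mult)
  have P: "h 0 r * h 1 r * h 2 r * h 3 r * h 4 r = qpoch_inf ((q ^ 5) ^ r) ((q ^ 5) ^ 5)" if "\<not> 5 dvd r" for r
  proof -
    have "(q ^ 5) ^ r = (q ^ r) ^ 5"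
      by (metis mult.commute power_mult)
    then show ?thesis
      using fifth_root_unity.prod_qpoch_inf[OF power_root[OF that] q5, of "q ^ r"] by (simp add: h_def)
  qed
  have h5: "h k 5 = euler (q ^ 5)" for k
    by (simp add: h_def euler_def power_5)
  have d: "\<not> 5 dvd (1::nat)" "\<not> 5 dvd (2::nat)" "\<not> 5 dvd (3::nat)" "\<not> 5 dvd (4::nat)"
    by simp_all
  have p5: "x * x * x * x * x = x ^ 5" for x :: complex
    by (simp add: eval_nat_numeral)
  have "euler (\<zeta> ^ 0 * q) * euler (\<zeta> ^ 1 * q) * euler (\<zeta> ^ 2 * q) * euler (\<zeta> ^ 3 * q) * euler (\<zeta> ^ 4 * q) =
     (h 0 1 * h 1 1 * h 2 1 * h 3 1 * h 4 1) * (h 0 2 * h 1 2 * h 2 2 * h 3 2 * h 4 2) *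
     (h 0 3 * h 1 3 * h 2 3 * h 3 3 * h 4 3) * (h 0 4 * h 1 4 * h 2 4 * h 3 4 * h 4 4) *
     (euler (q ^ 5) * euler (q ^ 5) * euler (q ^ 5) * euler (q ^ 5) * euler (q ^ 5))"
    unfolding e h5 by (simp only: mult_ac)
  also have "\<dots> = qpoch_inf ((q ^ 5) ^ 1) ((q ^ 5) ^ 5) * qpoch_inf ((q ^ 5) ^ 2) ((q ^ 5) ^ 5) *
      qpoch_inf ((q ^ 5) ^ 3) ((q ^ 5) ^ 5) * qpoch_inf ((q ^ 5) ^ 4) ((q ^ 5) ^ 5) * euler (q ^ 5) ^ 5"
    unfolding P[OF d(1)] P[OF d(2)] P[OF d(3)] P[OF d(4)] p5 ..
  finally have "euler (\<zeta> ^ 0 * q) * euler (\<zeta> ^ 1 * q) * euler (\<zeta> ^ 2 * q) * euler (\<zeta> ^ 3 * q) * euler (\<zeta> ^ 4 * q)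
      * qpoch_inf ((q ^ 5) ^ 5) ((q ^ 5) ^ 5) =
      (qpoch_inf (q ^ 5) ((q ^ 5) ^ 5) * qpoch_inf ((q ^ 5) ^ 2) ((q ^ 5) ^ 5) *
      qpoch_inf ((q ^ 5) ^ 3) ((q ^ 5) ^ 5) * qpoch_inf ((q ^ 5) ^ 4) ((q ^ 5) ^ 5) * qpoch_inf ((q ^ 5) ^ 5) ((q ^ 5) ^ 5))
      * euler (q ^ 5) ^ 5"
    by (simp only: power_one_right mult_ac)
  also have "\<dots> = euler (q ^ 5) * euler (q ^ 5) ^ 5"
    by (simp only: euler_quintisection[OF q5])
  also have "\<dots> = euler (q ^ 5) ^ 6"
    by (simp flip: power_Suc)
  finally show ?thesis
    by (simp add: euler_def)
qed

end

subsection \<open>Quintisection of a theta series\<close>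

lemma theta_term_eq:
  assumes "2 * e = n * (n - 1)"
  shows "theta_term q z n = (-1) powi n * q powi e * z powi n"
proof -
  have "n * (n - 1) div 2 = e" using assms by simp
  then show ?thesis by (simp add: theta_term_def)
qed

lemma rr_a_has_sum:
  assumes "norm q < 1" "q \<noteq> 0"
  shows "(theta_term (q ^ 5) q has_sum rr_a q) UNIV"
proof -
  have "q ^ 5 / q = q ^ 4" using assms by (simp add: eval_nat_numeral)
  then show ?thesis
    using jacobi_triple_product[of "q ^ 5" q] assms by (simp add: rr_a_def norm_power_less_1)
qed

lemma rr_b_has_sum:
  assumes "norm q < 1" "q \<noteq> 0"
  shows "(theta_term (q ^ 5) (q ^ 2) has_sum rr_b q) UNIV"
proof -
  have "q ^ 5 / q ^ 2 = q ^ 3" using assms by (simp add: eval_nat_numeral)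
  then show ?thesis
    using jacobi_triple_product[of "q ^ 5" "q ^ 2"] assms by (simp add: rr_b_def norm_power_less_1)
qed

context fifth_root_unity
begin

text \<open>In the triple product at \<open>z = \<zeta>\<close> the factor
  \<open>\<zeta> powi n\<close> depends only on \<open>n\<close> modulo 5. With
  \<open>n = 5 * m + r\<close>, the classes \<open>r = 0, 1\<close> give multiples of
  \<open>rr_b (q ^ 5)\<close>, the classes \<open>r = 2, -1\<close> give multiples of
  \<open>q * rr_a (q ^ 5)\<close>, and \<open>r = -2\<close> sums to zero.\<close>

lemma theta_quintisection_aux:
  assumes q: "norm q < 1" "q \<noteq> 0"
  shows "qpoch_inf \<zeta> q * qpoch_inf (q / \<zeta>) q * euler q =
    (1 - \<zeta>) * rr_b (q ^ 5) + (\<zeta> ^ 2 - \<zeta> ^ 4) * q * rr_a (q ^ 5)"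
proof -
  let ?f = "theta_term q \<zeta>"
  let ?S = "\<lambda>r. range (\<lambda>m. 5 * m + r)"
  have q5: "norm (q ^ 5) < 1" "q ^ 5 \<noteq> 0" using q by (simp_all add: norm_power_less_1)
  have z5: "\<zeta> powi (5 * m + r) = \<zeta> powi r" for m r
  proof -
    have "\<zeta> powi (5 * m) = (\<zeta> ^ 5) powi m" by (simp add: power_int_mult)
    then show ?thesis by (simp add: power_int_add nonzero power_5)
  qed
  have m1: "(-1) powi (5 * m + r) = ((-1) powi m * (-1) powi r :: complex)" for m r :: int
    by (auto simp: power_int_minus_left)
  have f: "?f (5 * m + r) = (-1) powi m * (-1) powi r * q powi e * \<zeta> powi r"
    if "2 * e = (5 * m + r) * (5 * m + r - 1)" for m r e
    unfolding theta_term_eq[OF that] z5 m1 ..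
  have powi: "q ^ n = q powi int n" for n by simp
  have tA: "q * theta_term ((q ^ 5) ^ 5) (q ^ 5) m = (-1) powi m * q powi e"
    if "2 * e = 25 * (m * (m - 1)) + 10 * m + 2" for m e
  proof -
    obtain c where c: "m * (m - 1) = 2 * c" using even_mult_pred by blast
    then have e: "e = 1 + 25 * c + 5 * m" using that by simp
    have "theta_term ((q ^ 5) ^ 5) (q ^ 5) m = (-1) powi m * ((q ^ 5) ^ 5) powi c * (q ^ 5) powi m"
      by (rule theta_term_eq) (simp add: c)
    moreover have "((q ^ 5) ^ 5) powi c = q powi (25 * c)" "(q ^ 5) powi m = q powi (5 * m)"
      by (simp_all add: power_int_mult flip: power_mult)
    ultimately show ?thesis using q by (simp add: e power_int_add)
  qed
  have tB: "theta_term ((q ^ 5) ^ 5) ((q ^ 5) ^ 2) m = (-1) powi m * q powi e"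
    if "2 * e = 25 * (m * (m - 1)) + 20 * m" for m e
  proof -
    obtain c where c: "m * (m - 1) = 2 * c" using even_mult_pred by blast
    then have e: "e = 25 * c + 10 * m" using that by simp
    have "theta_term ((q ^ 5) ^ 5) ((q ^ 5) ^ 2) m = (-1) powi m * ((q ^ 5) ^ 5) powi c * ((q ^ 5) ^ 2) powi m"
      by (rule theta_term_eq) (simp add: c)
    moreover have "((q ^ 5) ^ 5) powi c = q powi (25 * c)" "((q ^ 5) ^ 2) powi m = q powi (10 * m)"
      by (simp_all add: power_int_mult flip: power_mult)
    ultimately show ?thesis using q by (simp add: e power_int_add)
  qed
  have sA: "((\<lambda>m. q * theta_term ((q ^ 5) ^ 5) (q ^ 5) m) has_sum q * rr_a (q ^ 5)) UNIV"
    by (intro has_sum_cmult_right rr_a_has_sum q5)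
  have sB: "(theta_term ((q ^ 5) ^ 5) ((q ^ 5) ^ 2) has_sum rr_b (q ^ 5)) UNIV"
    by (intro rr_b_has_sum q5)
  have bij: "bij (uminus :: int \<Rightarrow> int)" by (rule bij_uminus)
  \<comment> \<open>The classes 1 and 2 match the target series only after reversing the index
    \<open>m\<close>.\<close>
  have sA': "((\<lambda>m. q * theta_term ((q ^ 5) ^ 5) (q ^ 5) (- m)) has_sum q * rr_a (q ^ 5)) UNIV"
    using sA has_sum_reindex_bij_betw[OF bij, of "\<lambda>m. q * theta_term ((q ^ 5) ^ 5) (q ^ 5) m"] by simp
  have sB': "((\<lambda>m. theta_term ((q ^ 5) ^ 5) ((q ^ 5) ^ 2) (- m)) has_sum rr_b (q ^ 5)) UNIV"
    using sB has_sum_reindex_bij_betw[OF bij, of "theta_term ((q ^ 5) ^ 5) ((q ^ 5) ^ 2)"] by simp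
  have cls: "(?f has_sum s) (?S r)" if "((\<lambda>m. ?f (5 * m + r)) has_sum s) UNIV" for r s
    using that by (subst has_sum_reindex) (auto simp: inj_def o_def)
  have total: "?f summable_on UNIV"
    using jacobi_triple_product[OF q nonzero] by (auto simp: summable_on_def)
  have P0: "(?f has_sum rr_b (q ^ 5)) (?S 0)"
  proof (rule cls)
    have "?f (5 * m + 0) = theta_term ((q ^ 5) ^ 5) ((q ^ 5) ^ 2) m" for m
    proof -
      obtain e where e: "(5 * m) * (5 * m - 1) = 2 * e" using even_mult_pred by blast
      show ?thesis using f[of e m 0] tB[of e m] e by (simp add: algebra_simps)
    qed
    then show "((\<lambda>m. ?f (5 * m + 0)) has_sum rr_b (q ^ 5)) UNIV" using sB by simp
  qed
  have P1: "(?f has_sum (- \<zeta> * rr_b (q ^ 5))) (?S 1)"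
  proof (rule cls)
    have "?f (5 * m + 1) = - \<zeta> * theta_term ((q ^ 5) ^ 5) ((q ^ 5) ^ 2) (- m)" for m
    proof -
      obtain e where e: "(5 * m + 1) * (5 * m + 1 - 1) = 2 * e" using even_mult_pred by blast
      show ?thesis using f[of e m 1] tB[of e "-m"] e by (simp add: algebra_simps power_int_minus_left)
    qed
    then show "((\<lambda>m. ?f (5 * m + 1)) has_sum (- \<zeta> * rr_b (q ^ 5))) UNIV"
      by (simp only: has_sum_cmult_right sB')
  qed
  have P2: "(?f has_sum (\<zeta> ^ 2 * (q * rr_a (q ^ 5)))) (?S 2)"
  proof (rule cls)
    have "?f (5 * m + 2) = \<zeta> ^ 2 * (q * theta_term ((q ^ 5) ^ 5) (q ^ 5) (- m))" for m
    proof -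
      obtain e where e: "(5 * m + 2) * (5 * m + 2 - 1) = 2 * e" using even_mult_pred by blast
      show ?thesis using f[of e m 2] tA[of e "-m"] e by (simp add: algebra_simps power_int_minus_left)
    qed
    then show "((\<lambda>m. ?f (5 * m + 2)) has_sum (\<zeta> ^ 2 * (q * rr_a (q ^ 5)))) UNIV"
      by (simp only: has_sum_cmult_right sA')
  qed
  have zm1: "\<zeta> powi (-1) = \<zeta> ^ 4"
    using power_5 nonzero by (simp add: power_int_minus field_simps eval_nat_numeral)
  have P3: "(?f has_sum (- (\<zeta> ^ 4) * (q * rr_a (q ^ 5)))) (?S (-1))"
  proof (rule cls)
    have "?f (5 * m + - 1) = - (\<zeta> ^ 4) * (q * theta_term ((q ^ 5) ^ 5) (q ^ 5) m)" for m
    proof -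
      obtain e where e: "(5 * m - 1) * (5 * m - 1 - 1) = 2 * e" using even_mult_pred by blast
      show ?thesis using f[of e m "-1"] tA[of e m] e zm1 by (simp add: algebra_simps power_int_minus_left)
    qed
    then show "((\<lambda>m. ?f (5 * m + - 1)) has_sum (- (\<zeta> ^ 4) * (q * rr_a (q ^ 5)))) UNIV"
      by (simp only: has_sum_cmult_right sA)
  qed
  text \<open>The last residue class cancels against itself under \<open>m \<rightarrow> 1 - m\<close>.\<close>
  have P4: "(?f has_sum 0) (?S (-2))"
  proof -
    let ?g = "\<lambda>m. ?f (5 * m + - 2)"
    have "?f summable_on ?S (-2)" using total summable_on_subset by blast
    then obtain s where s: "(?g has_sum s) UNIV"
      unfolding summable_on_def by (subst (asm) has_sum_reindex) (auto simp: inj_def o_def)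
    have anti: "?g (1 - m) = - ?g m" for m
    proof -
      obtain e where e: "(5 * m - 2) * (5 * m - 2 - 1) = 2 * e" using even_mult_pred by blast
      have "?g (1 - m) = (-1) powi (1 - m) * (-1) powi (- 2) * q powi e * \<zeta> powi (- 2)"
        by (rule f) (use e in \<open>simp add: algebra_simps\<close>)
      also have "\<dots> = - ((-1) powi m * (-1) powi (- 2) * q powi e * \<zeta> powi (- 2))"
        by (auto simp: power_int_minus_left)
      also have "(-1) powi m * (-1) powi (- 2) * q powi e * \<zeta> powi (- 2) = ?g m"
        by (rule f[symmetric]) (use e in \<open>simp add: algebra_simps\<close>)
      finally show ?thesis .
    qed
    have "bij (\<lambda>m::int. 1 - m)"
      by (rule bij_betw_byWitness[of _ "\<lambda>m. 1 - m"]) auto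
    from has_sum_reindex_bij_betw[OF this, of ?g] s have "((\<lambda>m. ?g (1 - m)) has_sum s) UNIV" by simp
    then have "((\<lambda>m. - ?g m) has_sum s) UNIV" unfolding anti .
    with has_sum_uminusI[OF s] have "- s = s" using has_sum_unique by blast
    then have "s = 0" by simp
    with s cls show ?thesis by blast
  qed
  define s where "s r = (if r = 0 then rr_b (q ^ 5) else if r = 1 then - \<zeta> * rr_b (q ^ 5) else
    if r = 2 then \<zeta> ^ 2 * (q * rr_a (q ^ 5)) else if r = -1 then - (\<zeta> ^ 4) * (q * rr_a (q ^ 5)) else 0)" for r :: int
  have A: "{-2..2::int} = {-2,-1,0,1,2}" by auto
  have "(?f has_sum sum s {-2..2}) (\<Union>r\<in>{-2..2::int}. ?S r)"
  proof (rule sum_has_sum)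
    show "(?f has_sum s r) (?S r)" if "r \<in> {-2..2}" for r
      using that P0 P1 P2 P3 P4 unfolding A s_def by auto
    show "?S r \<inter> ?S r' = {}" if "r \<in> {-2..2}" "r' \<in> {-2..2}" "r \<noteq> r'" for r r' :: int
    proof (rule ccontr)
      assume "?S r \<inter> ?S r' \<noteq> {}"
      then obtain m m' where "5 * m + r = 5 * m' + r'" by auto
      with that show False by simp presburger
    qed
  qed auto
  also have "(\<Union>r\<in>{-2..2::int}. ?S r) = UNIV"
  proof -
    have "n \<in> (\<Union>r\<in>{-2..2::int}. ?S r)" for n :: int
    proof (rule UN_I)
      show "(n + 2) mod 5 - 2 \<in> {-2..2}"
        using pos_mod_bound[of 5 "n + 2"] by simp
      have "n = 5 * ((n + 2) div 5) + ((n + 2) mod 5 - 2)"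
        using div_mult_mod_eq[of "n + 2" 5] by linarith
      then show "n \<in> ?S ((n + 2) mod 5 - 2)" by (rule range_eqI)
    qed
    then show ?thesis by auto
  qed
  finally have "(?f has_sum sum s {-2..2}) UNIV" .
  from has_sum_unique[OF jacobi_triple_product[OF q nonzero] this]
  have "qpoch_inf \<zeta> q * qpoch_inf (q / \<zeta>) q * euler q = sum s {-2..2}"
    unfolding euler_def .
  then show ?thesis by (simp add: A s_def algebra_simps)
qed

text \<open>Both sides of the preceding identity contain \<open>1 - \<zeta>\<close>: on the left as
  the first factor of \<open>qpoch_inf \<zeta> q\<close>, on the right because \<open>\<zeta> ^ 2 -
  \<zeta> ^ 4 = (1 - \<zeta>) * (\<zeta> ^ 2 + \<zeta> ^ 3)\<close>. Cancelling it leaves functions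
  with value 1 at \<open>q = 0\<close>.\<close>

lemma theta_quintisection:
  assumes "norm q < 1"
  shows "qpoch_inf (\<zeta> * q) q * qpoch_inf (\<zeta> ^ 4 * q) q * euler q =
    rr_b (q ^ 5) + (\<zeta> ^ 2 + \<zeta> ^ 3) * (q * rr_a (q ^ 5))"
proof (cases "q = 0")
  case True
  then show ?thesis by (simp add: qpoch_inf_def)
next
  case False
  have "q / \<zeta> = \<zeta> ^ 4 * q"
    using power_5 nonzero by (simp add: field_simps eval_nat_numeral)
  then have "(1 - \<zeta>) * (qpoch_inf (\<zeta> * q) q * qpoch_inf (\<zeta> ^ 4 * q) q * euler q) =
      (1 - \<zeta>) * rr_b (q ^ 5) + (\<zeta> ^ 2 - \<zeta> ^ 4) * q * rr_a (q ^ 5)"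
    using theta_quintisection_aux[OF assms False] qpoch_inf_Suc[OF assms, of \<zeta>] by (simp add: mult_ac)
  also have "\<dots> = (1 - \<zeta>) * (rr_b (q ^ 5) + (\<zeta> ^ 2 + \<zeta> ^ 3) * (q * rr_a (q ^ 5)))"
    by (simp add: algebra_simps eval_nat_numeral)
  finally show ?thesis using neq_1 by simp
qed

text \<open>The quintisections for \<open>\<zeta>\<close> and \<open>\<zeta> ^ 2\<close> are the two
  linear factors of the quadratic. On the product side the four nontrivial roots appear once each;
  one of the two copies of \<open>euler q\<close> supplies the trivial root and completes
  \<open>euler (q ^ 5)\<close>.\<close>

lemma rr_quadratic_aux:
  assumes "norm q < 1"
  shows "rr_b (q ^ 5) ^ 2 - (q * rr_a (q ^ 5)) * rr_b (q ^ 5) - (q * rr_a (q ^ 5)) ^ 2 = euler q * euler (q ^ 5)"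
proof -
  define b where "b = rr_b (q ^ 5)"
  define x where "x = q * rr_a (q ^ 5)"
  define s where "s = \<zeta> ^ 2 + \<zeta> ^ 3"
  define t where "t = \<zeta> + \<zeta> ^ 4"
  interpret sq: fifth_root_unity "\<zeta> ^ 2" by (rule power_root) simp
  have pw: "(\<zeta> ^ 2) ^ 4 = \<zeta> ^ 3" "(\<zeta> ^ 2) ^ 2 + (\<zeta> ^ 2) ^ 3 = t"
    using power_5 by (simp_all add: t_def eval_nat_numeral mult.assoc)
  have "s + t = -1" using sum_powers by (simp add: s_def t_def algebra_simps add_eq_0_iff)
  moreover have "s * t = -1"
    using sum_powers power_5 unfolding s_def t_def by algebra
  ultimately have "b ^ 2 - x * b - x ^ 2 = (b + s * x) * (b + t * x)"
    by algebra
  also have "\<dots> = (qpoch_inf (\<zeta> * q) q * qpoch_inf (\<zeta> ^ 4 * q) q * euler q) *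
      (qpoch_inf (\<zeta> ^ 2 * q) q * qpoch_inf (\<zeta> ^ 3 * q) q * euler q)"
    using theta_quintisection[OF assms] sq.theta_quintisection[OF assms]
    unfolding pw by (simp add: b_def x_def s_def)
  also have "\<dots> = euler q * euler (q ^ 5)"
    using prod_qpoch_inf[OF assms, of q] by (simp add: euler_def mult_ac)
  finally show ?thesis by (simp add: b_def x_def)
qed

end

subsection \<open>The quintic relation\<close>

lemma alpha_plus_beta: "\<alpha> + \<beta> = 1"
  unfolding \<alpha>_def \<beta>_def of_real_add[symmetric] by (simp add: field_simps)

lemma alpha_mult_beta: "\<alpha> * \<beta> = -1"
proof -
  have "(1 + sqrt 5) / 2 * ((1 - sqrt 5) / 2) = -1"
    by (simp add: field_simps flip: power2_eq_square)
  then show ?thesis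
    unfolding \<alpha>_def \<beta>_def of_real_mult[symmetric] by simp
qed

lemma alpha_neq_beta: "\<alpha> \<noteq> \<beta>"
  unfolding \<alpha>_def \<beta>_def of_real_eq_iff by simp

lemma alpha_square: "\<alpha> ^ 2 = \<alpha> + 1" and beta_square: "\<beta> ^ 2 = \<beta> + 1"
  using alpha_plus_beta alpha_mult_beta by algebra+

lemma quadratic_factor: "b ^ 2 - y * b - y ^ 2 = (b - \<alpha> * y) * (b - \<beta> * y)"
  using alpha_plus_beta alpha_mult_beta by algebra

section \<open>Algebra of the two quintic forms under the roots defining \<open>\<A>\<close> and
  \<open>\<B>\<close>\<close>

definition form_a :: "complex \<Rightarrow> complex \<Rightarrow> complex" where
  "form_a a b = a ^ 5 - 3 * a ^ 4 * b + 4 * a ^ 3 * b ^ 2 - 2 * a ^ 2 * b ^ 3 + a * b ^ 4"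

definition form_b :: "complex \<Rightarrow> complex \<Rightarrow> complex" where
  "form_b a b = b ^ 5 + 3 * b ^ 4 * a + 4 * b ^ 3 * a ^ 2 + 2 * b ^ 2 * a ^ 3 + b * a ^ 4"

lemma form_homogeneous:
  "form_a (c * a) (c * b) = c ^ 5 * form_a a b" "form_b (c * a) (c * b) = c ^ 5 * form_b a b"
  by (simp_all add: form_a_def form_b_def power_mult_distrib algebra_simps eval_nat_numeral)

text \<open>For a root of the golden ratio equation, powers reduce to linear expressions with
  Fibonacci coefficients, such as \<open>\<gamma> ^ 5 = 5 * \<gamma> + 3\<close>; the binomial
  expansion then splits into the two forms.\<close>

lemma form_fifth_power:
  assumes "\<gamma> ^ 2 = \<gamma> + 1"
  shows "form_b a b - \<gamma> ^ 5 * form_a a b = (b - \<gamma> * a) ^ 5"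
proof -
  have "\<gamma> ^ 3 = 2 * \<gamma> + 1" "\<gamma> ^ 4 = 3 * \<gamma> + 2" "\<gamma> ^ 5 = 5 * \<gamma> + 3"
    using assms by algebra+
  moreover have "(b - \<gamma> * a) ^ 5 = b ^ 5 - 5 * \<gamma> * a * b ^ 4 + 10 * \<gamma> ^ 2 * a ^ 2 * b ^ 3 -
      10 * \<gamma> ^ 3 * a ^ 3 * b ^ 2 + 5 * \<gamma> ^ 4 * a ^ 4 * b - \<gamma> ^ 5 * a ^ 5"
    by algebra
  ultimately show ?thesis
    unfolding form_a_def form_b_def assms by algebra
qed

text \<open>Besides the factors \<open>a\<close> and \<open>b\<close>, the two forms contain the
  quartics which, together with the quadratic, factor the form of degree 10.\<close>

lemma form_mult:
  "form_a a b * form_b a b * (b ^ 2 - a * b - a ^ 2) = a * b * (b ^ 10 - 11 * a ^ 5 * b ^ 5 - a ^ 10)"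
  unfolding form_a_def form_b_def by algebra

text \<open>This is the product of the two identities \<open>form_fifth_power\<close> for
  \<open>\<alpha>\<close> and \<open>\<beta>\<close>, as
  \<open>\<alpha> ^ 5 + \<beta> ^ 5 = 11\<close> and
  \<open>\<alpha> ^ 5 * \<beta> ^ 5 = -1\<close>.\<close>

lemma form_square:
  "form_b a b ^ 2 - 11 * form_a a b * form_b a b - form_a a b ^ 2 = (b ^ 2 - a * b - a ^ 2) ^ 5"
  unfolding form_a_def form_b_def by algebra

text \<open>
  The quadratic identity at each of the five arguments $\zeta^k q$ with $q^5 = p$ involves the same
  values \<open>rr_a p\<close> and \<open>rr_b p\<close>; multiplying these five identities gives the relation at level $p$.
\<close>

lemma (in fifth_root_unity) rr_quintic_aux:
  assumes "norm p < 1"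
  shows "(rr_b p ^ 10 - 11 * p * (rr_a p * rr_b p) ^ 5 - p ^ 2 * rr_a p ^ 10) * euler (p ^ 5) = euler p ^ 11"
proof -
  obtain q where p: "p = q ^ 5"
    using exists_complex_root[of 5 p] by auto
  have q: "norm q < 1"
    using assms unfolding p norm_power by (simp add: power_less_one_iff)
  define b where "b = rr_b p"
  define x where "x = q * rr_a p"
  have x5: "x ^ 5 = p * rr_a p ^ 5" by (simp add: x_def p power_mult_distrib)
  have step: "(b - \<zeta> ^ k * (\<alpha> * x)) * (b - \<zeta> ^ k * (\<beta> * x)) = euler (\<zeta> ^ k * q) * euler p" for k
  proof -
    have "(\<zeta> ^ k * q) ^ 5 = p"
      by (metis mult.left_neutral p power_5 power_mult power_mult_distrib power_one mult.commute)
    then have "b ^ 2 - \<zeta> ^ k * x * b - (\<zeta> ^ k * x) ^ 2 = euler (\<zeta> ^ k * q) * euler p"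
      using rr_quadratic_aux[of "\<zeta> ^ k * q"] q by (simp add: norm_mult norm_power norm_eq_1 b_def x_def mult_ac)
    then show ?thesis
      unfolding quadratic_factor by (simp only: mult.left_commute)
  qed
  \<comment> \<open>The ten linear factors are regrouped: collected by \<open>\<alpha>\<close> and
    \<open>\<beta>\<close> they are differences of fifth powers, collected by \<open>k\<close> they
    are the quadratics evaluated in \<open>step\<close>.\<close>
  have "(b ^ 5 - (\<alpha> * x) ^ 5) * (b ^ 5 - (\<beta> * x) ^ 5) =
      ((b - \<zeta> ^ 0 * (\<alpha> * x)) * (b - \<zeta> ^ 0 * (\<beta> * x))) * ((b - \<zeta> ^ 1 * (\<alpha> * x)) * (b - \<zeta> ^ 1 * (\<beta> * x))) *
      ((b - \<zeta> ^ 2 * (\<alpha> * x)) * (b - \<zeta> ^ 2 * (\<beta> * x))) * ((b - \<zeta> ^ 3 * (\<alpha> * x)) * (b - \<zeta> ^ 3 * (\<beta> * x))) *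
      ((b - \<zeta> ^ 4 * (\<alpha> * x)) * (b - \<zeta> ^ 4 * (\<beta> * x)))"
    unfolding prod_diff_mult[symmetric] power_0 power_one_right mult_1_left by (simp only: mult_ac)
  also have "\<dots> = (euler q * euler (\<zeta> * q) * euler (\<zeta> ^ 2 * q) * euler (\<zeta> ^ 3 * q) * euler (\<zeta> ^ 4 * q)) * euler p ^ 5"
    unfolding step by (simp add: eval_nat_numeral)
  finally have P: "(b ^ 5 - (\<alpha> * x) ^ 5) * (b ^ 5 - (\<beta> * x) ^ 5) =
      (euler q * euler (\<zeta> * q) * euler (\<zeta> ^ 2 * q) * euler (\<zeta> ^ 3 * q) * euler (\<zeta> ^ 4 * q)) * euler p ^ 5" .
  have p5: "p ^ 5 = q ^ 25" by (simp add: p flip: power_mult)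
  have "(b ^ 5 - (\<alpha> * x) ^ 5) * (b ^ 5 - (\<beta> * x) ^ 5) * euler (p ^ 5) =
      (euler q * euler (\<zeta> * q) * euler (\<zeta> ^ 2 * q) * euler (\<zeta> ^ 3 * q) * euler (\<zeta> ^ 4 * q) * euler (q ^ 25))
      * euler p ^ 5"
    unfolding P p5 by (simp only: mult_ac)
  also have "\<dots> = euler p ^ 6 * euler p ^ 5"
    unfolding prod_euler[OF q] p ..
  finally have "(b ^ 5 - (\<alpha> * x) ^ 5) * (b ^ 5 - (\<beta> * x) ^ 5) * euler (p ^ 5) = euler p ^ 6 * euler p ^ 5" .
  moreover have "\<alpha> ^ 5 + \<beta> ^ 5 = 11" "\<alpha> ^ 5 * \<beta> ^ 5 = -1"
    using alpha_plus_beta alpha_mult_beta by algebra+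
  moreover have "(b ^ 5 - (\<alpha> * x) ^ 5) * (b ^ 5 - (\<beta> * x) ^ 5) =
      b ^ 10 - (\<alpha> ^ 5 + \<beta> ^ 5) * x ^ 5 * b ^ 5 + (\<alpha> ^ 5 * \<beta> ^ 5) * (x ^ 5) ^ 2"
    by (simp add: algebra_simps power_mult_distrib flip: power_mult power_add)
  ultimately show ?thesis
    unfolding x5 b_def by (simp add: power_mult_distrib mult_ac flip: power_mult power_add)
qed

lemma exists_fifth_root_unity: "\<exists>\<zeta>. fifth_root_unity \<zeta>"
proof -
  have "card {z::complex. z ^ 5 = 1} = 5"
    by (rule card_roots_unity_eq) simp
  then have "\<not> {z::complex. z ^ 5 = 1} \<subseteq> {1}"
    using card_mono[of "{1::complex}" "{z. z ^ 5 = 1}"] by auto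
  then show ?thesis by (auto simp: fifth_root_unity_def)
qed

lemma
  assumes "norm q < 1"
  shows rr_quadratic: "rr_b (q ^ 5) ^ 2 - (q * rr_a (q ^ 5)) * rr_b (q ^ 5) - (q * rr_a (q ^ 5)) ^ 2 =
      euler q * euler (q ^ 5)"
    and rr_quintic: "(rr_b q ^ 10 - 11 * q * (rr_a q * rr_b q) ^ 5 - q ^ 2 * rr_a q ^ 10) * euler (q ^ 5) =
      euler q ^ 11"
  using exists_fifth_root_unity fifth_root_unity.rr_quadratic_aux fifth_root_unity.rr_quintic_aux assms by blast+

text \<open>Up to the common factor \<open>euler q ^ 3 * euler (q ^ 5) ^ 3\<close>, \<open>u\<close>
  and \<open>v\<close> are the fifth powers of \<open>A\<close> and \<open>B\<close> at
  \<open>q\<close>, and the right sides use the two forms in \<open>A\<close> and \<open>B\<close>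
  at \<open>q ^ 5\<close>. The product comes from \<open>form_mult\<close>, the difference of
  squares from \<open>form_square\<close>.\<close>

lemma rr_forms:
  assumes q: "norm q < 1"
  defines "x \<equiv> q * rr_a (q ^ 5)" and "b \<equiv> rr_b (q ^ 5)"
  defines "u \<equiv> q * rr_a q ^ 5 * euler (q ^ 5) ^ 3" and "v \<equiv> rr_b q ^ 5 * euler (q ^ 5) ^ 3"
  shows "u * v = (form_a x b * euler q ^ 3) * (form_b x b * euler q ^ 3)" (is ?prod)
    and "v ^ 2 - u ^ 2 = (form_b x b * euler q ^ 3) ^ 2 - (form_a x b * euler q ^ 3) ^ 2" (is ?diff)
proof -
  have q5: "norm (q ^ 5) < 1" using q by (simp add: norm_power_less_1)
  have q25: "norm ((q ^ 5) ^ 5) < 1" using q5 by (simp only: norm_power_less_1)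
  define e1 e5 e25 where "e1 = euler q" and "e5 = euler (q ^ 5)" and "e25 = euler ((q ^ 5) ^ 5)"
  have nz: "e1 \<noteq> 0" "e5 \<noteq> 0" "e25 \<noteq> 0"
    unfolding e1_def e5_def e25_def by (intro euler_nonzero q q5 q25)+
  have ab: "rr_a q * rr_b q = e1 * e5" and xb: "x * b = q * e5 * e25"
    using rr_a_mult_rr_b[OF q] rr_a_mult_rr_b[OF q5] by (simp_all add: e1_def e5_def e25_def x_def b_def)
  have N: "b ^ 2 - x * b - x ^ 2 = e1 * e5"
    using rr_quadratic[OF q] by (simp add: x_def b_def e1_def e5_def)
  \<comment> \<open>The quintic relation enters here at \<open>q ^ 5\<close>, to evaluate the degree
    10 form in \<open>x\<close> and \<open>b\<close>; the difference of squares below uses it at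
    \<open>q\<close> itself.\<close>
  have "(b ^ 10 - 11 * q ^ 5 * (rr_a (q ^ 5) * b) ^ 5 - (q ^ 5) ^ 2 * rr_a (q ^ 5) ^ 10) * e25 = e5 ^ 11"
    using rr_quintic[OF q5] by (simp add: b_def e5_def e25_def)
  then have Q: "(b ^ 10 - 11 * x ^ 5 * b ^ 5 - x ^ 10) * e25 = e5 ^ 11"
    by (simp add: x_def power_mult_distrib mult_ac flip: power_mult)
  have "form_a x b * form_b x b * (e1 * e5) = q * e5 * e25 * (b ^ 10 - 11 * x ^ 5 * b ^ 5 - x ^ 10)"
    using form_mult[of x b] unfolding N unfolding xb .
  then have "(form_a x b * form_b x b * (e1 * e5)) * e25 = (q * e5 * e25 * (b ^ 10 - 11 * x ^ 5 * b ^ 5 - x ^ 10)) * e25"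
    by simp
  then have "(form_a x b * form_b x b * e1) * (e5 * e25) =
      q * e5 * e25 * ((b ^ 10 - 11 * x ^ 5 * b ^ 5 - x ^ 10) * e25)"
    by (simp only: mult_ac)
  also have "\<dots> = (q * e5 ^ 11) * (e5 * e25)"
    unfolding Q by (simp only: mult_ac)
  finally have fab: "form_a x b * form_b x b * e1 = q * e5 ^ 11"
    using nz by simp
  have "u * v = q * (rr_a q * rr_b q) ^ 5 * e5 ^ 6"
    unfolding u_def v_def e5_def by (simp add: power_mult_distrib mult_ac flip: power_add)
  also have "\<dots> = q * e5 ^ 11 * e1 ^ 5"
    unfolding ab by (simp add: power_mult_distrib mult_ac flip: power_add)
  also have "\<dots> = (form_a x b * e1 ^ 3) * (form_b x b * e1 ^ 3)"
    unfolding fab[symmetric] by (simp add: eval_nat_numeral mult_ac)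
  finally show prod: ?prod by (simp add: e1_def)
  define fa fb where "fa = form_a x b" and "fb = form_b x b"
  have uv: "u * v = (fa * e1 ^ 3) * (fb * e1 ^ 3)"
    using prod by (simp add: fa_def fb_def e1_def)
  have "v ^ 2 - 11 * (u * v) - u ^ 2 = (rr_b q ^ 10 - 11 * q * (rr_a q * rr_b q) ^ 5 - q ^ 2 * rr_a q ^ 10) * e5 ^ 6"
    unfolding u_def v_def e5_def[symmetric] by (simp add: algebra_simps power_mult_distrib flip: power_mult power_add power_Suc)
  also have "\<dots> = (rr_b q ^ 10 - 11 * q * (rr_a q * rr_b q) ^ 5 - q ^ 2 * rr_a q ^ 10) * e5 * e5 ^ 5"
    by (simp flip: power_Suc)
  also have "\<dots> = e1 ^ 11 * e5 ^ 5"
    using rr_quintic[OF q] by (simp add: e1_def e5_def)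
  also have "\<dots> = (e1 * e5) ^ 5 * e1 ^ 6"
    by (simp add: power_mult_distrib mult_ac flip: power_add)
  also have "\<dots> = (fb ^ 2 - 11 * fa * fb - fa ^ 2) * e1 ^ 6"
    using form_square[of x b] unfolding N fa_def fb_def by simp
  also have "\<dots> = (fb * e1 ^ 3) ^ 2 - 11 * ((fa * e1 ^ 3) * (fb * e1 ^ 3)) - (fa * e1 ^ 3) ^ 2"
    by (simp add: algebra_simps power_mult_distrib flip: power_mult power_add)
  finally show ?diff
    unfolding uv unfolding fa_def fb_def e1_def by (simp add: algebra_simps)
qed

subsection \<open>Analytic continuation\<close>

text \<open>Near \<open>z0\<close> the quotient \<open>f / g\<close> is continuous with values among
  the finitely many \<open>n\<close>-th roots of unity, hence constantly 1. The identity theorem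
  carries the equality across any zeros of \<open>g\<close>.\<close>

lemma holomorphic_power_eq_imp_eq:
  fixes f g :: "complex \<Rightarrow> complex"
  assumes S: "open S" "connected S" and hol: "f holomorphic_on S" "g holomorphic_on S"
    and eq: "\<And>z. z \<in> S \<Longrightarrow> f z ^ n = g z ^ n" and n: "n > 0"
    and z0: "z0 \<in> S" "f z0 = g z0" "g z0 \<noteq> 0" and z: "z \<in> S"
  shows "f z = g z"
proof -
  have "continuous (at z0) g"
    using hol(2) S(1) z0(1) holomorphic_on_imp_continuous_on continuous_on_eq_continuous_at by blast
  then obtain d where d: "d > 0" "\<And>w. dist z0 w < d \<Longrightarrow> g w \<noteq> 0"
    using continuous_at_avoid[of z0 g 0] z0(3) by auto
  obtain e where e: "e > 0" "ball z0 e \<subseteq> S"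
    using S(1) z0(1) open_contains_ball by blast
  define r where "r = min d e"
  have r: "r > 0" "ball z0 r \<subseteq> S" "\<And>w. w \<in> ball z0 r \<Longrightarrow> g w \<noteq> 0"
    using d e by (auto simp: r_def subset_iff)
  have fin: "finite ((\<lambda>w. f w / g w) ` ball z0 r)"
  proof (rule finite_subset)
    show "(\<lambda>w. f w / g w) ` ball z0 r \<subseteq> {w. w ^ n = 1}"
      using eq r(2,3) by (auto simp: power_divide)
    show "finite {w::complex. w ^ n = 1}"
      using n by (intro finite_roots_unity) auto
  qed
  have "continuous_on (ball z0 r) (\<lambda>w. f w / g w)"
    using hol r by (intro continuous_intros holomorphic_on_imp_continuous_on) (auto elim: holomorphic_on_subset)
  then have "(\<lambda>w. f w / g w) constant_on ball z0 r"
    by (rule continuous_finite_range_constant[OF connected_ball _ fin])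
  then obtain c where c: "\<And>w. w \<in> ball z0 r \<Longrightarrow> f w / g w = c"
    by (auto simp: constant_on_def)
  have "c = 1" using c[of z0] z0 r(1) by simp
  then have "f w = g w" if "w \<in> ball z0 r" for w
    using c[OF that] r(3)[OF that] by (simp add: field_simps)
  then show ?thesis
    using analytic_continuation_open[OF open_ball S(1) _ S(2) r(2) hol] z r(1) by (simp add: z)
qed

text \<open>The description in \<open>fifth_root\<close> has at most one solution: high in the
  half-plane the quotient of two candidates is a constant fifth root of unity, and their common
  asymptotics force this constant to be 1.\<close>

lemma fifth_root_eqI:
  assumes g: "g holomorphic_on {z. Im z > 0}" "\<And>z. Im z > 0 \<Longrightarrow> g z ^ 5 = f z"
    and lim: "((\<lambda>z. g z / l z) \<longlongrightarrow> 1) (filtercomap Im at_top)"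
    and l: "\<And>z. l z \<noteq> 0" and \<tau>: "Im \<tau> > 0"
  shows "fifth_root l f \<tau> = g \<tau>"
  unfolding fifth_root_def
proof (rule the_equality)
  let ?H = "{z. Im z > 0}"
  show "\<exists>h. h holomorphic_on ?H \<and> (\<forall>z. Im z > 0 \<longrightarrow> h z ^ 5 = f z) \<and>
      ((\<lambda>z. h z / l z) \<longlongrightarrow> 1) (filtercomap Im at_top) \<and> g \<tau> = h \<tau>"
    using g lim by blast
  fix w
  assume "\<exists>h. h holomorphic_on ?H \<and> (\<forall>z. Im z > 0 \<longrightarrow> h z ^ 5 = f z) \<and>
      ((\<lambda>z. h z / l z) \<longlongrightarrow> 1) (filtercomap Im at_top) \<and> w = h \<tau>"
  then obtain h where h: "h holomorphic_on ?H" "\<And>z. Im z > 0 \<Longrightarrow> h z ^ 5 = f z"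
    and hlim: "((\<lambda>z. h z / l z) \<longlongrightarrow> 1) (filtercomap Im at_top)" and w: "w = h \<tau>" by blast
  \<comment> \<open>Without nontriviality of the filter, the constant could not be identified with
    the limit 1.\<close>
  have bot: "filtercomap Im at_top \<noteq> bot"
  proof
    assume "filtercomap Im at_top = bot"
    then have "eventually (\<lambda>_. False) (filtercomap Im at_top)" by simp
    then obtain b where "\<And>z. Im z \<ge> b \<Longrightarrow> False"
      unfolding eventually_filtercomap_at_top_linorder by auto
    from this[of "Complex 0 b"] show False by simp
  qed
  have "((\<lambda>z. (h z / l z) / (g z / l z)) \<longlongrightarrow> 1 / 1) (filtercomap Im at_top)"
    by (intro tendsto_divide hlim lim) auto
  then have ratio: "((\<lambda>z. h z / g z) \<longlongrightarrow> 1) (filtercomap Im at_top)"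
    using l by simp
  have ev: "eventually (\<lambda>z. g z / l z \<noteq> 0) (filtercomap Im at_top)"
    by (rule tendsto_imp_eventually_ne[OF lim]) simp
  then obtain b where b: "\<And>z. Im z \<ge> b \<Longrightarrow> g z \<noteq> 0"
    unfolding eventually_filtercomap_at_top_linorder by auto
  \<comment> \<open>Since \<open>g / l\<close> tends to 1, \<open>g\<close> has no zeros from height
    \<open>b\<close> on; the maximum with 0 keeps the region inside the upper half-plane.\<close>
  let ?T = "{z. Im z > max b 0}"
  have T: "g z \<noteq> 0" "z \<in> ?H" if "z \<in> ?T" for z using that b by auto
  have conT: "connected ?T" by (intro convex_connected convex_halfspace_Im_gt)
  have fin: "finite ((\<lambda>z. h z / g z) ` ?T)"
  proof (rule finite_subset)
    show "(\<lambda>z. h z / g z) ` ?T \<subseteq> {z. z ^ 5 = 1}"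
    proof clarify
      fix z assume z: "Im z > max b 0"
      then have "Im z > 0" "g z \<noteq> 0" using T by auto
      then show "(h z / g z) ^ 5 = 1" using g(2) h(2) by (simp add: power_divide flip: g(2))
    qed
    show "finite {z::complex. z ^ 5 = 1}"
      by (intro finite_roots_unity) auto
  qed
  have "continuous_on ?T (\<lambda>z. h z / g z)"
    using T by (intro continuous_intros continuous_on_subset[OF holomorphic_on_imp_continuous_on[OF g(1)]]
        continuous_on_subset[OF holomorphic_on_imp_continuous_on[OF h(1)]]) auto
  then have "(\<lambda>z. h z / g z) constant_on ?T"
    by (rule continuous_finite_range_constant[OF conT _ fin])
  then obtain c where c: "\<And>z. z \<in> ?T \<Longrightarrow> h z / g z = c"
    by (auto simp: constant_on_def)
  have "eventually (\<lambda>z. Im z \<ge> max b 0 + 1) (filtercomap Im at_top)"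
    unfolding eventually_filtercomap_at_top_linorder by blast
  then have "eventually (\<lambda>z. c = h z / g z) (filtercomap Im at_top)"
  proof eventually_elim
    case (elim z)
    then have "max b 0 < Im z" by linarith
    then show ?case using c[of z] by simp
  qed
  then have "((\<lambda>z. h z / g z) \<longlongrightarrow> c) (filtercomap Im at_top)"
    by (rule Lim_transform_eventually[OF tendsto_const])
  with ratio bot have "c = 1" using tendsto_unique by blast
  define z0 where "z0 = Complex 0 (max b 0 + 1)"
  have z0: "z0 \<in> ?T" by (simp add: z0_def max_def)
  have "h \<tau> = g \<tau>"
  proof (rule holomorphic_power_eq_imp_eq[of ?H h g 5 z0])
    show "open ?H" by (rule open_halfspace_Im_gt)
    show "connected ?H" by (simp add: convex_connected convex_halfspace_Im_gt)
    show "h z0 = g z0" "g z0 \<noteq> 0" "z0 \<in> ?H"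
      using T[OF z0] c[OF z0] \<open>c = 1\<close> by (auto simp: field_simps)
  qed (use g h \<tau> in auto)
  with w show "w = g \<tau>" by simp
qed

text \<open>The partial products converge uniformly on small closed discs inside the unit disc, by
  the Weierstrass test with a geometric majorant.\<close>

lemma qpoch_inf_power_holomorphic:
  assumes i: "i > 0" and j: "j > 0"
  shows "(\<lambda>q. qpoch_inf (q ^ i) (q ^ j)) holomorphic_on ball 0 1"
proof (rule holomorphic_uniform_sequence[OF open_ball])
  show "(\<lambda>q. \<Prod>k<n. 1 - q ^ i * (q ^ j) ^ k) holomorphic_on ball 0 1" for n
    by (intro holomorphic_intros)
  fix x :: complex
  assume x: "x \<in> ball 0 1"
  \<comment> \<open>Half the distance to the unit circle, so the closed disc about \<open>x\<close>
    stays within radius \<open>r < 1\<close>.\<close>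
  define d where "d = (1 - norm x) / 2"
  define r where "r = norm x + d"
  have d: "d > 0" "r < 1" "r \<ge> 0" using x by (auto simp: d_def r_def field_simps add_nonneg_nonneg)
  have nr: "norm q \<le> r" if "q \<in> cball x d" for q
    using that norm_triangle_ineq2[of q x] by (simp add: r_def dist_norm norm_minus_commute)
  have "uniformly_convergent_on (cball x d) (\<lambda>n q. \<Prod>k<n. 1 - q ^ i * (q ^ j) ^ k)"
  proof (rule uniformly_convergent_on_prod')
    show "uniformly_convergent_on (cball x d) (\<lambda>n q. \<Sum>k<n. norm (1 - q ^ i * (q ^ j) ^ k - 1))"
    proof (rule Weierstrass_m_test')
      show "summable (\<lambda>k. r ^ k)" using d by (intro summable_geometric) auto
      fix k q assume q: "q \<in> cball x d"
      have "norm q \<le> r" "norm q \<le> 1" using nr[OF q] d by auto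
      have "k \<le> i + j * k" using j by (cases j) auto
      then have "norm q ^ (i + j * k) \<le> norm q ^ k"
        using \<open>norm q \<le> 1\<close> by (intro power_decreasing) auto
      also have "\<dots> \<le> r ^ k"
        using \<open>norm q \<le> r\<close> by (intro power_mono) auto
      finally show "norm (norm (1 - q ^ i * (q ^ j) ^ k - 1)) \<le> r ^ k"
        by (simp add: norm_mult norm_power power_add power_mult)
    qed
  qed (auto intro!: continuous_intros)
  then have "uniform_limit (cball x d) (\<lambda>n q. \<Prod>k<n. 1 - q ^ i * (q ^ j) ^ k)
      (\<lambda>q. lim (\<lambda>n. \<Prod>k<n. 1 - q ^ i * (q ^ j) ^ k)) sequentially"
    by (simp only: uniformly_convergent_uniform_limit_iff)
  moreover have limit: "lim (\<lambda>n. \<Prod>k<n. 1 - q ^ i * (q ^ j) ^ k) = qpoch_inf (q ^ i) (q ^ j)" if "q \<in> cball x d" for q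
  proof -
    have "norm (q ^ j) < 1" using nr[OF that] d j by (intro norm_power_less_1) auto
    then show ?thesis
      using qpoch_LIMSEQ[of "q ^ j" "q ^ i"] unfolding qpoch_def by (intro limI)
  qed
  ultimately have "uniform_limit (cball x d) (\<lambda>n q. \<Prod>k<n. 1 - q ^ i * (q ^ j) ^ k)
      (\<lambda>q. qpoch_inf (q ^ i) (q ^ j)) sequentially"
    by (subst (asm) uniform_limit_cong'[OF refl limit])
  moreover have "cball x d \<subseteq> ball 0 1" using nr d by force
  ultimately show "\<exists>d>0. cball x d \<subseteq> ball 0 1 \<and> uniform_limit (cball x d)
      (\<lambda>n q. \<Prod>k<n. 1 - q ^ i * (q ^ j) ^ k) (\<lambda>q. qpoch_inf (q ^ i) (q ^ j)) sequentially"
    using d by blast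
qed

lemma euler_holomorphic: "euler holomorphic_on ball 0 1"
  using qpoch_inf_power_holomorphic[of 1 1] by (simp add: euler_def[abs_def])

lemma rr_holomorphic: "rr_a holomorphic_on ball 0 1" "rr_b holomorphic_on ball 0 1"
  unfolding rr_a_def[abs_def] rr_b_def[abs_def]
  using qpoch_inf_power_holomorphic[of 1 5] qpoch_inf_power_holomorphic[of _ 5]
  by (auto intro!: holomorphic_on_mult)

lemma holomorphic_on_power_ball:
  assumes "f holomorphic_on ball 0 1" "n > 0"
  shows "(\<lambda>q. f (q ^ n)) holomorphic_on ball 0 1"
proof -
  have "(f \<circ> (\<lambda>q. q ^ n)) holomorphic_on ball 0 1"
    using assms by (intro holomorphic_on_compose_gen[where t = "ball 0 1"] holomorphic_intros)
      (auto simp: norm_power_less_1)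
  then show ?thesis by (simp add: o_def)
qed

text \<open>The fifth power formulas with all fractional powers cleared. Both sides are then
  holomorphic in \<open>q\<close> on the whole disc, and \<open>q = 0\<close> can serve as base
  point.\<close>

lemma rr_quintisection:
  assumes q: "norm q < 1"
  defines "x \<equiv> \<lambda>q. q * rr_a (q ^ 5)" and "b \<equiv> \<lambda>q. rr_b (q ^ 5)"
  shows "q * rr_a q ^ 5 * euler (q ^ 5) ^ 3 = form_a (x q) (b q) * euler q ^ 3"
    and "rr_b q ^ 5 * euler (q ^ 5) ^ 3 = form_b (x q) (b q) * euler q ^ 3"
proof -
  define u v u' v' where "u = (\<lambda>q. q * rr_a q ^ 5 * euler (q ^ 5) ^ 3)"
    and "v = (\<lambda>q. rr_b q ^ 5 * euler (q ^ 5) ^ 3)"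
    and "u' = (\<lambda>q. form_a (x q) (b q) * euler q ^ 3)"
    and "v' = (\<lambda>q. form_b (x q) (b q) * euler q ^ 3)"
  have hol: "u holomorphic_on ball 0 1" "v holomorphic_on ball 0 1"
    "u' holomorphic_on ball 0 1" "v' holomorphic_on ball 0 1"
    unfolding u_def v_def u'_def v'_def x_def b_def form_a_def form_b_def
    by (intro holomorphic_intros euler_holomorphic rr_holomorphic holomorphic_on_power_ball; simp)+
  text \<open>
    \<open>u v = u' v'\<close> and \<open>v\<^sup>2 - u\<^sup>2 = v'\<^sup>2 - u'\<^sup>2\<close> say exactly that \<open>(v +- \<i> u)\<^sup>2 = (v' +- \<i> u')\<^sup>2\<close>;
    the sign of the square root is fixed by the value \<open>1\<close> at \<open>q = 0\<close>.
  \<close>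
  have eq: "v z + c * u z = v' z + c * u' z" if c: "c ^ 2 = -1" and z: "z \<in> ball 0 1" for c z
  proof (rule holomorphic_power_eq_imp_eq[of "ball 0 1" "\<lambda>z. v z + c * u z" "\<lambda>z. v' z + c * u' z" 2 0])
    show "(\<lambda>z. v z + c * u z) holomorphic_on ball 0 1" "(\<lambda>z. v' z + c * u' z) holomorphic_on ball 0 1"
      by (intro holomorphic_intros hol)+
    show "(v z + c * u z) ^ 2 = (v' z + c * u' z) ^ 2" if "z \<in> ball 0 1" for z
    proof -
      have "u z * v z = u' z * v' z" "v z ^ 2 - u z ^ 2 = v' z ^ 2 - u' z ^ 2"
        using rr_forms[of z] that by (simp_all add: u_def v_def u'_def v'_def x_def b_def)
      moreover have "(y + c * w) ^ 2 = (y ^ 2 - w ^ 2) + 2 * c * (w * y)" for y w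
        by (simp add: power2_sum power_mult_distrib c)
      ultimately show ?thesis by simp
    qed
    show "v 0 + c * u 0 = v' 0 + c * u' 0" "v' 0 + c * u' 0 \<noteq> 0"
      by (simp_all add: u_def v_def u'_def v'_def x_def b_def form_a_def form_b_def)
  qed (use z in auto)
  have "q \<in> ball 0 1" using q by simp
  from eq[OF _ this, of \<i>] eq[OF _ this, of "- \<i>"] have "v q + \<i> * u q = v' q + \<i> * u' q" "v q - \<i> * u q = v' q - \<i> * u' q"
    by simp_all
  then have "(v q + \<i> * u q) + (v q - \<i> * u q) = (v' q + \<i> * u' q) + (v' q - \<i> * u' q)"
    "(v q + \<i> * u q) - (v q - \<i> * u q) = (v' q + \<i> * u' q) - (v' q - \<i> * u' q)"
    by simp_all
  then have "v q = v' q" "u q = u' q"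
    by simp_all
  then show "q * rr_a q ^ 5 * euler (q ^ 5) ^ 3 = form_a (x q) (b q) * euler q ^ 3"
    "rr_b q ^ 5 * euler (q ^ 5) ^ 3 = form_b (x q) (b q) * euler q ^ 3"
    by (simp_all add: u_def v_def u'_def v'_def)
qed

text \<open>As \<open>euler\<close> has no zeros on the simply connected disc, it has a holomorphic
  logarithm there, which provides the branch; \<open>holomorphic_power_eq_imp_eq\<close> at 0 makes
  it unique.\<close>

lemma euler_pow_holomorphic: "euler_pow holomorphic_on ball 0 1"
  and euler_pow_0: "euler_pow 0 = 1"
  and euler_pow_5: "norm q < 1 \<Longrightarrow> euler_pow q ^ 5 * euler q ^ 3 = 1"
proof -
  let ?B = "ball (0::complex) 1"
  have nz: "\<forall>z\<in>?B. euler z \<noteq> 0" using euler_nonzero by auto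
  have "simply_connected ?B" by (intro convex_imp_simply_connected convex_ball)
  then obtain L where L: "L holomorphic_on ?B" "\<And>z. z \<in> ?B \<Longrightarrow> euler z = exp (L z)"
    using euler_holomorphic nz unfolding simply_connected_eq_holomorphic_log[OF open_ball] by blast
  \<comment> \<open>Subtracting \<open>L 0\<close>, possibly a nonzero multiple of
    \<open>2 * pi * \<i>\<close>, normalizes the constant term to 1.\<close>
  define g where "g z = exp (- 3 * (L z - L 0) / 5)" for z
  have g: "g holomorphic_on ?B" unfolding g_def[abs_def] by (intro holomorphic_intros L) auto
  have g0: "g 0 = 1" by (simp add: g_def)
  have g5: "g z ^ 5 = euler z powi (-3)" if "z \<in> ?B" for z
  proof -
    have "exp (L 0) = 1" using L(2)[of 0] by simp
    have "g z ^ 5 = exp (- 3 * (L z - L 0))"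
    proof -
      have "- 3 * w = of_nat 5 * (- 3 * w / 5)" for w :: complex by simp
      then have "exp (- 3 * (L z - L 0)) = exp (of_nat 5 * (- 3 * (L z - L 0) / 5))" by (rule arg_cong)
      also have "\<dots> = g z ^ 5" unfolding g_def by (rule exp_of_nat_mult)
      finally show ?thesis ..
    qed
    also have "\<dots> = inverse (exp (3 * L z)) * exp (3 * L 0)"
      by (simp add: exp_minus[symmetric] exp_add[symmetric] algebra_simps)
    also have "exp (3 * L 0) = exp (L 0) ^ 3"
      by (subst exp_of_nat_mult[symmetric]) simp
    also have "exp (3 * L z) = exp (L z) ^ 3"
      by (subst exp_of_nat_mult[symmetric]) simp
    finally show ?thesis
      using \<open>exp (L 0) = 1\<close> by (simp add: L(2)[OF that] power_int_minus)
  qed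
  have eq: "euler_pow z = g z" if z: "z \<in> ?B" for z
    unfolding euler_pow_def euler_def[symmetric]
  proof (rule the_equality)
    show "\<exists>h. h holomorphic_on ?B \<and> h 0 = 1 \<and> (\<forall>z\<in>?B. h z ^ 5 = euler z powi (-3)) \<and> g z = h z"
      using g g0 g5 by blast
    fix w assume "\<exists>h. h holomorphic_on ?B \<and> h 0 = 1 \<and> (\<forall>z\<in>?B. h z ^ 5 = euler z powi (-3)) \<and> w = h z"
    then obtain h where h: "h holomorphic_on ?B" "h 0 = 1" "\<And>z. z \<in> ?B \<Longrightarrow> h z ^ 5 = euler z powi (-3)"
      and w: "w = h z" by blast
    have "h z = g z"
      by (rule holomorphic_power_eq_imp_eq[of ?B h g 5 0]) (use h g g0 g5 z in auto)
    with w show "w = g z" by simp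
  qed
  show "euler_pow holomorphic_on ?B"
    using g eq by (metis holomorphic_transform)
  show "euler_pow 0 = 1" using eq[of 0] g0 by simp
  show "euler_pow q ^ 5 * euler q ^ 3 = 1" if "norm q < 1"
    using eq[of q] g5[of q] euler_nonzero[OF that] that by (simp add: power_int_minus)
qed

subsection \<open>Functions on the upper half-plane\<close>

lemma qpow_nonzero [simp]: "qpow r \<tau> \<noteq> 0"
  by (simp add: qpow_def)

lemma qpow_add: "qpow (r + s) \<tau> = qpow r \<tau> * qpow s \<tau>"
  by (simp add: qpow_def exp_add[symmetric] algebra_simps)

lemma qpow_power: "qpow r \<tau> ^ n = qpow (of_nat n * r) \<tau>"
  unfolding qpow_def exp_of_nat_mult[symmetric] by (simp add: mult_ac)

lemma qpow_powi: "qpow r \<tau> powi n = qpow (of_int n * r) \<tau>"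
proof (cases n rule: int_cases2)
  case (nonneg k)
  then show ?thesis by (simp add: qpow_power)
next
  case (nonpos k)
  have "qpow (- (of_nat k * r)) \<tau> * qpow (of_nat k * r) \<tau> = 1"
    unfolding qpow_add[symmetric] by (simp add: qpow_def)
  then show ?thesis
    using nonpos by (simp add: power_int_minus qpow_power field_simps)
qed

lemma qpow_scale: "qpow r (of_real s * \<tau>) = qpow (r * s) \<tau>"
  by (simp add: qpow_def mult_ac)

lemma norm_qpow: "norm (qpow r \<tau>) = exp (- (2 * pi * r * Im \<tau>))"
  by (simp add: qpow_def)

lemma norm_qpow_less_1: "r > 0 \<Longrightarrow> Im \<tau> > 0 \<Longrightarrow> norm (qpow r \<tau>) < 1"
  by (simp add: norm_qpow)

lemma qpow_tendsto_0:
  assumes "r > 0"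
  shows "(qpow r \<longlongrightarrow> 0) (filtercomap Im at_top)"
proof (rule tendsto_norm_zero_cancel)
  have "filterlim (\<lambda>y. 2 * pi * r * y) at_top at_top"
    using assms by (intro filterlim_tendsto_pos_mult_at_top[OF tendsto_const] filterlim_ident) simp
  then have "((\<lambda>y. exp (- (2 * pi * r * y))) \<longlongrightarrow> 0) at_top"
    by (intro filterlim_compose[OF exp_at_bot] filterlim_compose[OF filterlim_uminus_at_bot_at_top])
  then show "((\<lambda>z. norm (qpow r z)) \<longlongrightarrow> 0) (filtercomap Im at_top)"
    unfolding norm_qpow by (rule filterlim_compose) (rule filterlim_filtercomap)
qed

lemma qpow_holomorphic: "qpow r holomorphic_on S"
  unfolding qpow_def[abs_def] by (intro holomorphic_intros)

text \<open>Since \<open>(5 * n^2 - 3 * n) / 2 = 5 * n * (n - 1) / 2 + n\<close>, the sum is the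
  theta series with base \<open>q ^ 5\<close> at \<open>z = q\<close>, to which the triple product
  applies.\<close>

lemma A_fun_eq:
  assumes "Im \<tau> > 0"
  shows "A_fun \<tau> = qpow (1/5) \<tau> * (euler_pow (qpow 1 \<tau>) * rr_a (qpow 1 \<tau>))"
proof -
  have q: "norm (qpow 1 \<tau>) < 1" using assms by (simp add: norm_qpow_less_1)
  have "(-1) powi n * qpow ((5 * of_int n ^ 2 - 3 * of_int n) / 2) \<tau> = theta_term (qpow 1 \<tau> ^ 5) (qpow 1 \<tau>) n" for n
  proof -
    obtain c where c: "n * (n - 1) = 2 * c" using even_mult_pred by blast
    then have "of_int n * (of_int n - 1) = (2 * of_int c :: real)"
      by (metis of_int_diff of_int_mult of_int_numeral of_int_1)
    then have "(5 * of_int n ^ 2 - 3 * of_int n) / 2 = of_int c * (of_nat 5 * 1) + of_int n * (1 :: real)"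
      by (simp add: field_simps power2_eq_square)
    then show ?thesis
      unfolding theta_term_eq[OF c[symmetric]] qpow_power qpow_powi mult.assoc by (simp only: qpow_add)
  qed
  then show ?thesis
    using infsumI[OF rr_a_has_sum[OF q]] unfolding A_fun_def by (simp add: mult.assoc)
qed

lemma B_fun_eq:
  assumes "Im \<tau> > 0"
  shows "B_fun \<tau> = euler_pow (qpow 1 \<tau>) * rr_b (qpow 1 \<tau>)"
proof -
  have q: "norm (qpow 1 \<tau>) < 1" using assms by (simp add: norm_qpow_less_1)
  have "(-1) powi n * qpow ((5 * of_int n ^ 2 - of_int n) / 2) \<tau> = theta_term (qpow 1 \<tau> ^ 5) (qpow 1 \<tau> ^ 2) n" for n
  proof -
    obtain c where c: "n * (n - 1) = 2 * c" using even_mult_pred by blast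
    then have "of_int n * (of_int n - 1) = (2 * of_int c :: real)"
      by (metis of_int_diff of_int_mult of_int_numeral of_int_1)
    then have "(5 * of_int n ^ 2 - of_int n) / 2 = of_int c * (of_nat 5 * 1) + of_int n * (of_nat 2 * (1 :: real))"
      by (simp add: field_simps power2_eq_square)
    then show ?thesis
      unfolding theta_term_eq[OF c[symmetric]] qpow_power qpow_powi mult.assoc by (simp only: qpow_add)
  qed
  then show ?thesis
    using infsumI[OF rr_b_has_sum[OF q]] unfolding B_fun_def by simp
qed

text \<open>Replacing \<open>\<tau>\<close> by \<open>5 * \<tau>\<close> replaces \<open>q\<close>
  by \<open>q ^ 5\<close>, and the prefactor \<open>qpow (1/5)\<close> becomes \<open>q\<close>, the
  factor needed in \<open>x\<close>.\<close>

lemma pentamidiation: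
  assumes "Im \<tau> > 0"
  shows "A_fun \<tau> ^ 5 = form_a (A_fun (5 * \<tau>)) (B_fun (5 * \<tau>))"
    and "B_fun \<tau> ^ 5 = form_b (A_fun (5 * \<tau>)) (B_fun (5 * \<tau>))"
proof -
  define q where "q = qpow 1 \<tau>"
  have q: "norm q < 1" using assms by (simp add: q_def norm_qpow_less_1)
  then have q5: "norm (q ^ 5) < 1" by (simp add: norm_power_less_1)
  define e e' where "e = euler_pow q" and "e' = euler_pow (q ^ 5)"
  define x b where "x = q * rr_a (q ^ 5)" and "b = rr_b (q ^ 5)"
  have scale: "qpow r (5 * \<tau>) = qpow (5 * r) \<tau>" for r
    using qpow_scale[of r 5] by (simp add: mult.commute)
  have "q ^ 5 = qpow 1 (5 * \<tau>)" "q = qpow (1/5) (5 * \<tau>)" "qpow (1/5) \<tau> ^ 5 = q"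
    by (simp_all add: q_def scale qpow_power)
  then have AB: "A_fun (5 * \<tau>) = e' * x" "B_fun (5 * \<tau>) = e' * b"
    "A_fun \<tau> ^ 5 = e ^ 5 * (q * rr_a q ^ 5)" "B_fun \<tau> ^ 5 = e ^ 5 * rr_b q ^ 5"
    using assms by (simp_all add: A_fun_eq B_fun_eq e_def e'_def x_def b_def power_mult_distrib mult_ac flip: q_def)
  have E: "e ^ 5 * euler q ^ 3 = 1" "e' ^ 5 * euler (q ^ 5) ^ 3 = 1"
    unfolding e_def e'_def by (intro euler_pow_5 q q5)+
  \<comment> \<open>The fifth powers of \<open>e\<close> and \<open>e'\<close> invert the cubes of
    \<open>euler q\<close> and \<open>euler (q ^ 5)\<close>, so the cleared identities pass to the
    normalized functions.\<close>
  have "e ^ 5 * y = e' ^ 5 * w" if "y * euler (q ^ 5) ^ 3 = w * euler q ^ 3" for y w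
  proof -
    have "e ^ 5 * y = e ^ 5 * (y * euler (q ^ 5) ^ 3) * e' ^ 5"
      using E(2) by (simp add: mult_ac)
    also have "\<dots> = (e ^ 5 * euler q ^ 3) * (e' ^ 5 * w)"
      unfolding that by (simp only: mult_ac)
    finally show ?thesis by (simp add: E)
  qed
  from this[OF rr_quintisection(1)[OF q]] this[OF rr_quintisection(2)[OF q]]
  show "A_fun \<tau> ^ 5 = form_a (A_fun (5 * \<tau>)) (B_fun (5 * \<tau>))"
    "B_fun \<tau> ^ 5 = form_b (A_fun (5 * \<tau>)) (B_fun (5 * \<tau>))"
    unfolding AB form_homogeneous by (simp_all add: x_def b_def)
qed

section \<open>Holomorphy and asymptotics of \<open>A\<close> and \<open>B\<close> on the upper
  half-plane\<close>

lemma qpow_comp_holomorphic: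
  assumes "f holomorphic_on ball 0 1" "r > 0"
  shows "(\<lambda>\<tau>. f (qpow r \<tau>)) holomorphic_on {\<tau>. Im \<tau> > 0}"
proof -
  have "(f \<circ> qpow r) holomorphic_on {\<tau>. Im \<tau> > 0}"
    using assms norm_qpow_less_1[of r]
    by (intro holomorphic_on_compose_gen[where t = "ball 0 1"] qpow_holomorphic) auto
  then show ?thesis by (simp add: o_def)
qed

lemma qpow_comp_tendsto:
  assumes "f holomorphic_on ball 0 1" "r > 0"
  shows "((\<lambda>\<tau>. f (qpow r \<tau>)) \<longlongrightarrow> f 0) (filtercomap Im at_top)"
proof -
  have "isCont f 0"
    using holomorphic_on_imp_continuous_on[OF assms(1)] by (simp add: continuous_on_eq_continuous_at)
  then show ?thesis
    using isCont_tendsto_compose qpow_tendsto_0[OF assms(2)] by blast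
qed

lemma eventually_Im_pos: "eventually (\<lambda>\<tau>. Im \<tau> > 0) (filtercomap Im at_top)"
  unfolding eventually_filtercomap using eventually_gt_at_top by blast

lemma scaled_functions:
  assumes s: "s > 0"
  shows A_fun_scaled: "Im \<tau> > 0 \<Longrightarrow> A_fun (of_real s * \<tau>) =
      qpow (s / 5) \<tau> * (euler_pow (qpow s \<tau>) * rr_a (qpow s \<tau>))"
    and B_fun_scaled: "Im \<tau> > 0 \<Longrightarrow> B_fun (of_real s * \<tau>) = euler_pow (qpow s \<tau>) * rr_b (qpow s \<tau>)"
    and A_fun_scaled_holomorphic: "(\<lambda>\<tau>. A_fun (of_real s * \<tau>)) holomorphic_on {\<tau>. Im \<tau> > 0}"
    and B_fun_scaled_holomorphic: "(\<lambda>\<tau>. B_fun (of_real s * \<tau>)) holomorphic_on {\<tau>. Im \<tau> > 0}"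
    and A_fun_scaled_tendsto: "((\<lambda>\<tau>. A_fun (of_real s * \<tau>) / qpow (s / 5) \<tau>) \<longlongrightarrow> 1) (filtercomap Im at_top)"
    and A_fun_scaled_tendsto_0: "((\<lambda>\<tau>. A_fun (of_real s * \<tau>)) \<longlongrightarrow> 0) (filtercomap Im at_top)"
    and B_fun_scaled_tendsto: "((\<lambda>\<tau>. B_fun (of_real s * \<tau>)) \<longlongrightarrow> 1) (filtercomap Im at_top)"
proof -
  show A: "A_fun (of_real s * \<tau>) = qpow (s / 5) \<tau> * (euler_pow (qpow s \<tau>) * rr_a (qpow s \<tau>))"
    if "Im \<tau> > 0" for \<tau>
    using that s by (subst A_fun_eq) (simp_all add: qpow_scale)
  show B: "B_fun (of_real s * \<tau>) = euler_pow (qpow s \<tau>) * rr_b (qpow s \<tau>)"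
    if "Im \<tau> > 0" for \<tau>
    using that s by (subst B_fun_eq) (simp_all add: qpow_scale)
  have hol: "(\<lambda>q. euler_pow q * rr_a q) holomorphic_on ball 0 1" "(\<lambda>q. euler_pow q * rr_b q) holomorphic_on ball 0 1"
    by (intro holomorphic_on_mult euler_pow_holomorphic rr_holomorphic)+
  show "(\<lambda>\<tau>. A_fun (of_real s * \<tau>)) holomorphic_on {\<tau>. Im \<tau> > 0}"
    using holomorphic_on_mult[OF qpow_holomorphic[of "s / 5"] qpow_comp_holomorphic[OF hol(1) s]]
    by (rule holomorphic_transform) (simp add: A)
  show "(\<lambda>\<tau>. B_fun (of_real s * \<tau>)) holomorphic_on {\<tau>. Im \<tau> > 0}"
    using qpow_comp_holomorphic[OF hol(2) s]
    by (rule holomorphic_transform) (simp add: B)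
  have limA: "((\<lambda>\<tau>. euler_pow (qpow s \<tau>) * rr_a (qpow s \<tau>)) \<longlongrightarrow> 1) (filtercomap Im at_top)"
    using qpow_comp_tendsto[OF hol(1) s] by (simp add: euler_pow_0)
  have limB: "((\<lambda>\<tau>. euler_pow (qpow s \<tau>) * rr_b (qpow s \<tau>)) \<longlongrightarrow> 1) (filtercomap Im at_top)"
    using qpow_comp_tendsto[OF hol(2) s] by (simp add: euler_pow_0)
  show "((\<lambda>\<tau>. A_fun (of_real s * \<tau>) / qpow (s / 5) \<tau>) \<longlongrightarrow> 1) (filtercomap Im at_top)"
    using limA by (rule Lim_transform_eventually) (use eventually_Im_pos in eventually_elim, simp add: A)
  have "((\<lambda>\<tau>. qpow (s / 5) \<tau> * (euler_pow (qpow s \<tau>) * rr_a (qpow s \<tau>))) \<longlongrightarrow> 0 * 1) (filtercomap Im at_top)"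
    using s by (intro tendsto_mult limA qpow_tendsto_0) simp
  then have "((\<lambda>\<tau>. A_fun (of_real s * \<tau>)) \<longlongrightarrow> 0 * 1) (filtercomap Im at_top)"
    by (rule Lim_transform_eventually) (use eventually_Im_pos in eventually_elim, simp add: A)
  then show "((\<lambda>\<tau>. A_fun (of_real s * \<tau>)) \<longlongrightarrow> 0) (filtercomap Im at_top)" by simp
  show "((\<lambda>\<tau>. B_fun (of_real s * \<tau>)) \<longlongrightarrow> 1) (filtercomap Im at_top)"
    using limB by (rule Lim_transform_eventually) (use eventually_Im_pos in eventually_elim, simp add: B)
qed

section \<open>Identification of the fifth roots with rescaled \<open>A\<close> and
  \<open>B\<close>\<close>

lemma cal_A_eq: "Im \<tau> > 0 \<Longrightarrow> \<A> \<tau> = A_fun (of_real (1/5) * \<tau>)"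
  unfolding \<A>_def
proof (rule fifth_root_eqI[where g = "\<lambda>\<tau>. A_fun (of_real (1/5) * \<tau>)"])
  show "A_fun (of_real (1/5) * \<tau>) ^ 5 = (let A = A_fun \<tau>; B = B_fun \<tau> in
      A ^ 5 - 3 * A ^ 4 * B + 4 * A ^ 3 * B\<^sup>2 - 2 * A\<^sup>2 * B ^ 3 + A * B ^ 4)" if "Im \<tau> > 0" for \<tau>
    using pentamidiation(1)[of "of_real (1/5) * \<tau>"] that by (simp add: form_a_def Let_def)
  \<comment> \<open>The leading term \<open>q^(1/5)\<close> of \<open>A\<close> at
    \<open>\<tau> / 5\<close> is \<open>q^(1/25)\<close>, the one prescribed for
    \<open>\<A>\<close>.\<close>
  show "((\<lambda>\<tau>. A_fun (of_real (1/5) * \<tau>) / qpow (1/25) \<tau>) \<longlongrightarrow> 1) (filtercomap Im at_top)"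
    using A_fun_scaled_tendsto[of "1/5"] by simp
  show "(\<lambda>\<tau>. A_fun (of_real (1/5) * \<tau>)) holomorphic_on {\<tau>. Im \<tau> > 0}"
    by (rule A_fun_scaled_holomorphic) simp
qed auto

lemma cal_B_eq: "Im \<tau> > 0 \<Longrightarrow> \<B> \<tau> = B_fun (of_real (1/5) * \<tau>)"
  unfolding \<B>_def
proof (rule fifth_root_eqI[where g = "\<lambda>\<tau>. B_fun (of_real (1/5) * \<tau>)"])
  show "B_fun (of_real (1/5) * \<tau>) ^ 5 = (let A = A_fun \<tau>; B = B_fun \<tau> in
      B ^ 5 + 3 * B ^ 4 * A + 4 * B ^ 3 * A\<^sup>2 + 2 * B\<^sup>2 * A ^ 3 + B * A ^ 4)" if "Im \<tau> > 0" for \<tau>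
    using pentamidiation(2)[of "of_real (1/5) * \<tau>"] that by (simp add: form_b_def Let_def)
  show "((\<lambda>\<tau>. B_fun (of_real (1/5) * \<tau>) / 1) \<longlongrightarrow> 1) (filtercomap Im at_top)"
    using B_fun_scaled_tendsto[of "1/5"] by simp
  show "(\<lambda>\<tau>. B_fun (of_real (1/5) * \<tau>)) holomorphic_on {\<tau>. Im \<tau> > 0}"
    by (rule B_fun_scaled_holomorphic) simp
qed auto

text \<open>Pentamidiation and \<open>form_fifth_power\<close> exhibit the radicand as an exact
  fifth power; the branch is right because \<open>A\<close> tends to 0 and \<open>B\<close> to 1 as
  \<open>q\<close> tends to 0.\<close>

lemma fifth_root_pentication:
  assumes "\<gamma> ^ 2 = \<gamma> + 1" "Im \<tau> > 0"
  shows "fifth_root (\<lambda>_. 1) (\<lambda>\<tau>. B_fun \<tau> ^ 5 - \<gamma> ^ 5 * A_fun \<tau> ^ 5) \<tau> = B_fun (5 * \<tau>) - \<gamma> * A_fun (5 * \<tau>)"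
proof (rule fifth_root_eqI[where g = "\<lambda>\<tau>. B_fun (5 * \<tau>) - \<gamma> * A_fun (5 * \<tau>)"])
  show "(\<lambda>\<tau>. B_fun (5 * \<tau>) - \<gamma> * A_fun (5 * \<tau>)) holomorphic_on {\<tau>. Im \<tau> > 0}"
    using A_fun_scaled_holomorphic[of 5] B_fun_scaled_holomorphic[of 5] by (intro holomorphic_intros) simp_all
  show "(B_fun (5 * \<tau>) - \<gamma> * A_fun (5 * \<tau>)) ^ 5 = B_fun \<tau> ^ 5 - \<gamma> ^ 5 * A_fun \<tau> ^ 5" if "Im \<tau> > 0" for \<tau>
    using pentamidiation[OF that] form_fifth_power[OF assms(1)] by simp
  have "((\<lambda>\<tau>. B_fun (of_real 5 * \<tau>) - \<gamma> * A_fun (of_real 5 * \<tau>)) \<longlongrightarrow> 1 - \<gamma> * 0) (filtercomap Im at_top)"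
    by (intro tendsto_diff tendsto_mult tendsto_const B_fun_scaled_tendsto A_fun_scaled_tendsto_0) simp_all
  then show "((\<lambda>\<tau>. (B_fun (5 * \<tau>) - \<gamma> * A_fun (5 * \<tau>)) / 1) \<longlongrightarrow> 1) (filtercomap Im at_top)" by simp
qed (use assms in auto)

text \<open>The defining quotients of \<open>\<C>\<close> and \<open>\<D>\<close> solve the linear
  system that gives \<open>B - \<alpha> * A\<close> and \<open>B - \<beta> * A\<close> at
  \<open>5 * \<tau>\<close>.\<close>

lemma cal_C_eq: "Im \<tau> > 0 \<Longrightarrow> \<C> \<tau> = A_fun (5 * \<tau>)"
  and cal_D_eq: "Im \<tau> > 0 \<Longrightarrow> \<D> \<tau> = B_fun (5 * \<tau>)"
  using alpha_neq_beta
  by (simp_all add: \<C>_def \<D>_def root_alpha_def root_beta_def fifth_root_pentication alpha_square beta_square field_simps)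

theorem theorem3p3:
  fixes \<Omega> :: "complex \<Rightarrow> complex \<Rightarrow> complex \<Rightarrow> complex"
  assumes "\<forall>\<tau>. Im \<tau> > 0 \<longrightarrow> \<Omega> (qpow 1 \<tau>) (A_fun \<tau>) (B_fun \<tau>) = 0"
  shows "(\<forall>\<tau>. Im \<tau> > 0 \<longrightarrow> \<Omega> (qpow (1/5) \<tau>) (\<A> \<tau>) (\<B> \<tau>) = 0) \<and>
         (\<forall>\<tau>. Im \<tau> > 0 \<longrightarrow> \<Omega> (qpow 5 \<tau>) (\<C> \<tau>) (\<D> \<tau>) = 0)"
proof (intro conjI allI impI)
  fix \<tau> assume \<tau>: "Im \<tau> > 0"
  show "\<Omega> (qpow (1/5) \<tau>) (\<A> \<tau>) (\<B> \<tau>) = 0"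
    \<comment> \<open>The relation holds at every point of the upper half-plane, so it may be read
      at \<open>\<tau> / 5\<close> here and at \<open>5 * \<tau>\<close> below.\<close>
    using assms[rule_format, of "of_real (1/5) * \<tau>"] \<tau> qpow_scale[of 1 "1/5" \<tau>]
    by (simp add: cal_A_eq cal_B_eq)
  show "\<Omega> (qpow 5 \<tau>) (\<C> \<tau>) (\<D> \<tau>) = 0"
    using assms[rule_format, of "5 * \<tau>"] \<tau> qpow_scale[of 1 5 \<tau>]
    by (simp add: cal_C_eq cal_D_eq)
qed

end
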